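(* Let $\mathcal L=(H,L,s,t,\gamma,\pi)$ be a left bialgebroid and $B$ an $L$-ring. Crossed products $B\#_\sigma\mathcal L$ and $B\#_{\bar\sigma}\mathcal L$ are equivalent if and only if $B\#_{\bar\sigma}\mathcal L$ is a gauge transform of $B\#_\sigma\mathcal L$.
   Context: $k$ is a commutative unital ring; algebras are associative unital $k$-algebras; an $L$-ring is an algebra $B$ with an algebra map $\iota:L\to B$. Summations are suppressed. Left bialgebroid $\mathcal L=(H,L,s,t,\gamma,\pi)$: algebras $H,L$; algebra maps $s:L\to H$, $t:L^{op}\to H$ with commuting images; $H$ is an $L$-bimodule via $lhl'=s(l)t(l')h$; $L$-bimodule maps $\gamma:H\to H\otimes_LH$, $h\mapsto h_{(1)}\otimes_Lh_{(2)}$, $\pi:H\to L$ form a coassociative counital $L$-coring; $h_{(1)}t(l)\otimes_Lh_{(2)}=h_{(1)}\otimes_Lh_{(2)}s(l)$; $\gamma(1)=1\otimes_L1$, $\gamma(hh')=\gamma(h)\gamma(h')$; $\pi(1)=1$; $\pi(hs(\pi(h')))=\pi(hh')=\pi(ht(\pi(h')))$. $\mathcal L$ measures $B$ if there is a $k$-linear map (measuring) $H\otimes_kB\to B$, $h\otimes b\mapsto h\cdot b$, with $h\cdot1_B=\iota(\pi(h))$; $(t(l)h)\cdot b=(h\cdot b)\iota(l)$, $(s(l)h)\cdot b=\iota(l)(h\cdot b)$; $h\cdot(bb')=(h_{(1)}\cdot b)(h_{(2)}\cdot b')$. For such $B$, a ($B$-valued) 2-cocycle is a $k$-linear map $\sigma:H\otimes_{L^{op}}H\to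 B$ (so $\sigma(ht(l),k)=\sigma(h,t(l)k)$) with (a) $\sigma(s(l)h,k)=\iota(l)\sigma(h,k)$, $\sigma(t(l)h,k)=\sigma(h,k)\iota(l)$; (b) $(h_{(1)}\cdot\iota(l))\sigma(h_{(2)},k)=\sigma(h,s(l)k)$; (c) $\sigma(1,h)=\iota(\pi(h))=\sigma(h,1)$; (d) $[h_{(1)}\cdot\sigma(k_{(1)},m_{(1)})]\sigma(h_{(2)},k_{(2)}m_{(2)})=\sigma(h_{(1)},k_{(1)})\sigma(h_{(2)}k_{(2)},m)$. $B$ is a $\sigma$-twisted left $\mathcal L$-module if moreover (e) $1_H\cdot b=b$; (f) $[h_{(1)}\cdot(k_{(1)}\cdot b)]\sigma(h_{(2)},k_{(2)})=\sigma(h_{(1)},k_{(1)})(h_{(2)}k_{(2)}\cdot b)$. Given a measuring and a 2-cocycle $\sigma$ with $B$ $\sigma$-twisted, the crossed product $B\#_\sigma\mathcal L$ is the $k$-module $B\otimes_LH$ (left $L$-action on $H$ by left multiplication by $s(l)$) with unit $1_B\otimes_L1_H$ and product $(b\otimes_Lh)(b'\otimes_Lh')=b(h_{(1)}\cdot b')\sigma(h_{(2)},h'_{(1)})\otimes_Lh_{(3)}h'_{(2)}$. It is a left $B$-module via $B$ and a right $\mathcal L$-comodule algebra with coaction $B\otimes_L\gamma$. The two crossed products $B\#_\sigma\mathcal L$, $B\#_{\bar\sigma}\mathcal L$ each have their own measuring of $B$ (on the same $L$-ring $B$). Equivalent: there is a left $B$-module isomorphism of right $\mathcal L$-comodule algebras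 (i.e. a bijective left $B$-linear, $\mathcal L$-colinear algebra map) $B\#_{\bar\sigma}\mathcal L\to B\#_\sigma\mathcal L$. Gauge transform: let $\mathrm{Hom}_{L,L}(H,B)$ be the convolution algebra of $k$-linear maps $\chi:H\to B$ with $\chi(s(l)t(l')h)=\iota(l)\chi(h)\iota(l')$, with product $(\chi\diamond\chi')(h)=\chi(h_{(1)})\chi'(h_{(2)})$ and unit $\iota\circ\pi$. For a convolution invertible $\chi$ with $\chi(1_H)=1_B$ and inverse $\chi^{c}$, the gauge transform of $B\#_\sigma\mathcal L$ by $\chi$ is the crossed product with measuring $h\cdot^\chi b=\chi(h_{(1)})(h_{(2)}\cdot b)\chi^{c}(h_{(3)})$ and 2-cocycle $\sigma^\chi(h,k)=\chi(h_{(1)})(h_{(2)}\cdot\chi(k_{(1)}))\sigma(h_{(3)},k_{(2)})\chi^{c}(h_{(4)}k_{(3)})$. "A gauge transform" means the gauge transform by some such $\chi$. *)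

theory Defs
  imports "HOL-Library.Multiset"
begin

text \<open>
  Algebras live on types of sort \<open>{ring, monoid_mult}\<close>, and the ground ring on a type of sort
  \<open>{comm_ring, comm_monoid_mult}\<close>, instead of \<open>ring_1\<close> and \<open>comm_ring_1\<close>, because the latter
  classes exclude the zero ring.
\<close>

locale k_algebra =
  fixes scale :: "'k::{comm_ring,comm_monoid_mult} \<Rightarrow> 'a::{ring,monoid_mult} \<Rightarrow> 'a"
  assumes scale_add_right: "scale c (x + y) = scale c x + scale c y"
    and scale_add_left: "scale (c + d) x = scale c x + scale d x"
    and scale_mult: "scale (c * d) x = scale c (scale d x)"
    and scale_one: "scale 1 x = x"
    and scale_mult_left: "scale c x * y = scale c (x * y)"
    and scale_mult_right: "x * scale c y = scale c (x * y)"

definition k_linear ::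
    "('k \<Rightarrow> 'a::ab_group_add \<Rightarrow> 'a) \<Rightarrow> ('k \<Rightarrow> 'b::ab_group_add \<Rightarrow> 'b) \<Rightarrow> ('a \<Rightarrow> 'b) \<Rightarrow> bool" where
  "k_linear scA scB f \<longleftrightarrow>
     (\<forall>x y. f (x + y) = f x + f y) \<and> (\<forall>c x. f (scA c x) = scB c (f x))"

definition algebra_map ::
    "('k \<Rightarrow> 'a::{ring,monoid_mult} \<Rightarrow> 'a) \<Rightarrow> ('k \<Rightarrow> 'b::{ring,monoid_mult} \<Rightarrow> 'b) \<Rightarrow>
     ('a \<Rightarrow> 'b) \<Rightarrow> bool" where
  "algebra_map scA scB f \<longleftrightarrow>
     k_linear scA scB f \<and> f 1 = 1 \<and> (\<forall>x y. f (x * y) = f x * f y)"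

definition algebra_antimap ::
    "('k \<Rightarrow> 'a::{ring,monoid_mult} \<Rightarrow> 'a) \<Rightarrow> ('k \<Rightarrow> 'b::{ring,monoid_mult} \<Rightarrow> 'b) \<Rightarrow>
     ('a \<Rightarrow> 'b) \<Rightarrow> bool" where
  "algebra_antimap scA scB f \<longleftrightarrow>
     k_linear scA scB f \<and> f 1 = 1 \<and> (\<forall>x y. f (x * y) = f y * f x)"


section \<open>Tensor products over a noncommutative ring\<close>

text \<open>
  A multiset of tuples is read as a formal sum of pure tensors. A tensor product is the quotient of
  the formal sums by the congruence generated by multiadditivity and balancedness;
  its elements are the congruence classes. Natural coefficients suffice, because
  \<open>(-a) \<otimes> b\<close> is the negative of \<open>a \<otimes> b\<close>. All actions of \<open>L\<close> used below are
  compatible with the actions of the ground ring (which factor through \<open>L\<close>), so that balancedness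
  over \<open>L\<close> includes balancedness over the ground ring.
\<close>

inductive fs_cong :: "('x multiset \<Rightarrow> 'x multiset \<Rightarrow> bool) \<Rightarrow> 'x multiset \<Rightarrow> 'x multiset \<Rightarrow> bool"
  for R where
  base: "R x y \<Longrightarrow> fs_cong R x y"
| refl: "fs_cong R x x"
| sym: "fs_cong R x y \<Longrightarrow> fs_cong R y x"
| trans: "fs_cong R x y \<Longrightarrow> fs_cong R y z \<Longrightarrow> fs_cong R x z"
| add: "fs_cong R x y \<Longrightarrow> fs_cong R (x + z) (y + z)"

text \<open>\<open>ra\<close> is the right action of \<open>L\<close> on the first factor, \<open>lb\<close> the left action on the second.\<close>

inductive tensor_rel ::
    "('a::ab_group_add \<Rightarrow> 'l \<Rightarrow> 'a) \<Rightarrow> ('l \<Rightarrow> 'b::ab_group_add \<Rightarrow> 'b) \<Rightarrow>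
     ('a \<times> 'b) multiset \<Rightarrow> ('a \<times> 'b) multiset \<Rightarrow> bool"
  for ra lb where
  "tensor_rel ra lb {#(a + a', b)#} {#(a, b), (a', b)#}"
| "tensor_rel ra lb {#(a, b + b')#} {#(a, b), (a, b')#}"
| "tensor_rel ra lb {#(0, b)#} {#}"
| "tensor_rel ra lb {#(a, 0)#} {#}"
| "tensor_rel ra lb {#(ra a l, b)#} {#(a, lb l b)#}"

inductive tensor3_rel ::
    "('a::ab_group_add \<Rightarrow> 'l \<Rightarrow> 'a) \<Rightarrow> ('l \<Rightarrow> 'b::ab_group_add \<Rightarrow> 'b) \<Rightarrow>
     ('b \<Rightarrow> 'l \<Rightarrow> 'b) \<Rightarrow> ('l \<Rightarrow> 'c::ab_group_add \<Rightarrow> 'c) \<Rightarrow>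
     ('a \<times> 'b \<times> 'c) multiset \<Rightarrow> ('a \<times> 'b \<times> 'c) multiset \<Rightarrow> bool"
  for ra lb rb lc where
  "tensor3_rel ra lb rb lc {#(a + a', b, c)#} {#(a, b, c), (a', b, c)#}"
| "tensor3_rel ra lb rb lc {#(a, b + b', c)#} {#(a, b, c), (a, b', c)#}"
| "tensor3_rel ra lb rb lc {#(a, b, c + c')#} {#(a, b, c), (a, b, c')#}"
| "tensor3_rel ra lb rb lc {#(0, b, c)#} {#}"
| "tensor3_rel ra lb rb lc {#(a, 0, c)#} {#}"
| "tensor3_rel ra lb rb lc {#(a, b, 0)#} {#}"
| "tensor3_rel ra lb rb lc {#(ra a l, b, c)#} {#(a, lb l b, c)#}"
| "tensor3_rel ra lb rb lc {#(a, rb b l, c)#} {#(a, b, lc l c)#}"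

definition fs_class :: "('x multiset \<Rightarrow> 'x multiset \<Rightarrow> bool) \<Rightarrow> 'x multiset \<Rightarrow> 'x multiset set" where
  "fs_class R x = {y. fs_cong R x y}"

definition rep :: "'x multiset set \<Rightarrow> 'x multiset" where
  "rep X = (SOME x. x \<in> X)"

text \<open>
  \<open>tsum f X\<close> is the sum of the \<open>f a b\<close> over a chosen decomposition of \<open>X\<close> into pure tensors.
  It does not depend on the choice if \<open>f\<close> is biadditive and balanced modulo the congruence at hand,
  which holds (with the values of \<open>f\<close> read in the respective quotient) in each use below
  under the preceding axioms. Where several elements are decomposed, the
  nesting is such that this holds at each level from the inside to the outside.
\<close>

definition tsum :: "('a \<Rightarrow> 'b \<Rightarrow> 'c::comm_monoid_add) \<Rightarrow> ('a \<times> 'b) multiset set \<Rightarrow> 'c" where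
  "tsum f X = (\<Sum>(a, b)\<in>#rep X. f a b)"

definition tsum3 ::
    "('a \<Rightarrow> 'b \<Rightarrow> 'c \<Rightarrow> 'd::comm_monoid_add) \<Rightarrow> ('a \<times> 'b \<times> 'c) multiset set \<Rightarrow> 'd" where
  "tsum3 f X = (\<Sum>(a, b, c)\<in>#rep X. f a b c)"


section \<open>Left bialgebroids\<close>

record ('h, 'l) bialgebroid_data =
  src :: "'l \<Rightarrow> 'h"
  tgt :: "'l \<Rightarrow> 'h"
  comul :: "'h \<Rightarrow> ('h \<times> 'h) multiset set"
  counit :: "'h \<Rightarrow> 'l"

text \<open>The \<open>L\<close>-bimodule structure of \<open>H\<close> is \<open>l h l' = s(l) t(l') h\<close>.\<close>

definition lactH :: "('h::{ring,monoid_mult}, 'l) bialgebroid_data \<Rightarrow> 'l \<Rightarrow> 'h \<Rightarrow> 'h" where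
  "lactH BG l h = src BG l * h"

definition ractH :: "('h::{ring,monoid_mult}, 'l) bialgebroid_data \<Rightarrow> 'h \<Rightarrow> 'l \<Rightarrow> 'h" where
  "ractH BG h l = tgt BG l * h"

definition clsHH ::
    "('h::{ring,monoid_mult}, 'l) bialgebroid_data \<Rightarrow> ('h \<times> 'h) multiset \<Rightarrow> ('h \<times> 'h) multiset set" where
  "clsHH BG = fs_class (tensor_rel (ractH BG) (lactH BG))"

definition clsHHH ::
    "('h::{ring,monoid_mult}, 'l) bialgebroid_data \<Rightarrow>
     ('h \<times> 'h \<times> 'h) multiset \<Rightarrow> ('h \<times> 'h \<times> 'h) multiset set" where
  "clsHHH BG = fs_class (tensor3_rel (ractH BG) (lactH BG) (ractH BG) (lactH BG))"

text \<open>\<open>sw BG h (\<lambda>h1 h2. e)\<close> is the Sweedler expression \<open>e\<close> in the components of \<open>\<gamma>(h)\<close>.\<close>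

definition sw ::
    "('h, 'l) bialgebroid_data \<Rightarrow> 'h \<Rightarrow> ('h \<Rightarrow> 'h \<Rightarrow> 'c::comm_monoid_add) \<Rightarrow> 'c" where
  "sw BG h f = tsum f (comul BG h)"

definition sw3 ::
    "('h, 'l) bialgebroid_data \<Rightarrow> 'h \<Rightarrow> ('h \<Rightarrow> 'h \<Rightarrow> 'h \<Rightarrow> 'c::comm_monoid_add) \<Rightarrow> 'c" where
  "sw3 BG h f = sw BG h (\<lambda>h1 h'. sw BG h' (\<lambda>h2 h3. f h1 h2 h3))"

definition sw4 ::
    "('h, 'l) bialgebroid_data \<Rightarrow> 'h \<Rightarrow> ('h \<Rightarrow> 'h \<Rightarrow> 'h \<Rightarrow> 'h \<Rightarrow> 'c::comm_monoid_add) \<Rightarrow> 'c" where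
  "sw4 BG h f = sw BG h (\<lambda>h1 h'. sw3 BG h' (\<lambda>h2 h3 h4. f h1 h2 h3 h4))"

locale left_bialgebroid =
  H: k_algebra scH + L: k_algebra scL
  for scH :: "'k::{comm_ring,comm_monoid_mult} \<Rightarrow> 'h::{ring,monoid_mult} \<Rightarrow> 'h"
    and scL :: "'k \<Rightarrow> 'l::{ring,monoid_mult} \<Rightarrow> 'l" +
  fixes BG :: "('h, 'l) bialgebroid_data"
  assumes src_algebra_map: "algebra_map scL scH (src BG)"
    and tgt_algebra_map: "algebra_antimap scL scH (tgt BG)"
    and src_tgt_commute: "src BG l * tgt BG l' = tgt BG l' * src BG l"
    and comul_in: "comul BG h \<in> range (clsHH BG)"
    and comul_add: "comul BG (h + h') = clsHH BG (rep (comul BG h) + rep (comul BG h'))"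
    and comul_bimodule:
      "comul BG (src BG l * tgt BG l' * h) =
         clsHH BG (sw BG h (\<lambda>h1 h2. {#(src BG l * h1, tgt BG l' * h2)#}))"
    and counit_add: "counit BG (h + h') = counit BG h + counit BG h'"
    and counit_bimodule: "counit BG (src BG l * tgt BG l' * h) = l * counit BG h * l'"
    and coassoc:
      "clsHHH BG (sw BG h (\<lambda>h1 h2. sw BG h1 (\<lambda>h11 h12. {#(h11, h12, h2)#}))) =
       clsHHH BG (sw BG h (\<lambda>h1 h2. sw BG h2 (\<lambda>h21 h22. {#(h1, h21, h22)#})))"
    and counit_left: "sw BG h (\<lambda>h1 h2. src BG (counit BG h1) * h2) = h"
    and counit_right: "sw BG h (\<lambda>h1 h2. tgt BG (counit BG h2) * h1) = h"
    and takeuchi: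
      "clsHH BG (sw BG h (\<lambda>h1 h2. {#(h1 * tgt BG l, h2)#})) =
       clsHH BG (sw BG h (\<lambda>h1 h2. {#(h1, h2 * src BG l)#}))"
    and comul_one: "comul BG 1 = clsHH BG {#(1, 1)#}"
    and comul_mult:
      "comul BG (h * h') =
         clsHH BG (sw BG h' (\<lambda>h1' h2'. sw BG h (\<lambda>h1 h2. {#(h1 * h1', h2 * h2')#})))"
    and counit_one: "counit BG 1 = 1"
    and counit_mult_src: "counit BG (h * src BG (counit BG h')) = counit BG (h * h')"
    and counit_mult_tgt: "counit BG (h * tgt BG (counit BG h')) = counit BG (h * h')"

locale L_ring = L: k_algebra scL + B: k_algebra scB
  for scL :: "'k::{comm_ring,comm_monoid_mult} \<Rightarrow> 'l::{ring,monoid_mult} \<Rightarrow> 'l"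
    and scB :: "'k \<Rightarrow> 'b::{ring,monoid_mult} \<Rightarrow> 'b" +
  fixes \<iota> :: "'l \<Rightarrow> 'b"
  assumes algebra_map: "algebra_map scL scB \<iota>"


section \<open>Measurings, cocycles and crossed products\<close>

text \<open>
  Linear maps out of \<open>H \<otimes>\<^sub>k B\<close> and \<open>H \<otimes> H\<close> (over \<open>L\<^sup>o\<^sup>p\<close>) are given as bilinear,
  respectively bilinear balanced, maps of two arguments.
\<close>

record ('h, 'b) crossed_product_data =
  meas :: "'h \<Rightarrow> 'b \<Rightarrow> 'b"
  coc :: "'h \<Rightarrow> 'h \<Rightarrow> 'b"

definition measuring ::
    "('k \<Rightarrow> 'h::{ring,monoid_mult} \<Rightarrow> 'h) \<Rightarrow> ('k \<Rightarrow> 'b::{ring,monoid_mult} \<Rightarrow> 'b) \<Rightarrow>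
     ('h, 'l) bialgebroid_data \<Rightarrow> ('l \<Rightarrow> 'b) \<Rightarrow> ('h \<Rightarrow> 'b \<Rightarrow> 'b) \<Rightarrow> bool" where
  "measuring scH scB BG \<iota> m \<longleftrightarrow>
     (\<forall>h. k_linear scB scB (m h)) \<and>
     (\<forall>b. k_linear scH scB (\<lambda>h. m h b)) \<and>
     (\<forall>h. m h 1 = \<iota> (counit BG h)) \<and>
     (\<forall>l h b. m (tgt BG l * h) b = m h b * \<iota> l) \<and>
     (\<forall>l h b. m (src BG l * h) b = \<iota> l * m h b) \<and>
     (\<forall>h b b'. m h (b * b') = sw BG h (\<lambda>h1 h2. m h1 b * m h2 b'))"

definition two_cocycle ::
    "('k \<Rightarrow> 'h::{ring,monoid_mult} \<Rightarrow> 'h) \<Rightarrow> ('k \<Rightarrow> 'b::{ring,monoid_mult} \<Rightarrow> 'b) \<Rightarrow>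
     ('h, 'l) bialgebroid_data \<Rightarrow> ('l \<Rightarrow> 'b) \<Rightarrow> ('h \<Rightarrow> 'b \<Rightarrow> 'b) \<Rightarrow> ('h \<Rightarrow> 'h \<Rightarrow> 'b) \<Rightarrow> bool" where
  "two_cocycle scH scB BG \<iota> m \<sigma> \<longleftrightarrow>
     (\<forall>h. k_linear scH scB (\<sigma> h)) \<and>
     (\<forall>k. k_linear scH scB (\<lambda>h. \<sigma> h k)) \<and>
     (\<forall>h k l. \<sigma> (h * tgt BG l) k = \<sigma> h (tgt BG l * k)) \<and>
     (\<forall>l h k. \<sigma> (src BG l * h) k = \<iota> l * \<sigma> h k) \<and>
     (\<forall>l h k. \<sigma> (tgt BG l * h) k = \<sigma> h k * \<iota> l) \<and>
     (\<forall>l h k. sw BG h (\<lambda>h1 h2. m h1 (\<iota> l) * \<sigma> h2 k) = \<sigma> h (src BG l * k)) \<and>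
     (\<forall>h. \<sigma> 1 h = \<iota> (counit BG h)) \<and>
     (\<forall>h. \<sigma> h 1 = \<iota> (counit BG h)) \<and>
     (\<forall>h k n.
        sw BG n (\<lambda>n1 n2. sw BG k (\<lambda>k1 k2. sw BG h (\<lambda>h1 h2.
          m h1 (\<sigma> k1 n1) * \<sigma> h2 (k2 * n2)))) =
        sw BG k (\<lambda>k1 k2. sw BG h (\<lambda>h1 h2. \<sigma> h1 k1 * \<sigma> (h2 * k2) n)))"

definition twisted_module ::
    "('h::{ring,monoid_mult}, 'l) bialgebroid_data \<Rightarrow>
     ('h \<Rightarrow> 'b::{ring,monoid_mult} \<Rightarrow> 'b) \<Rightarrow> ('h \<Rightarrow> 'h \<Rightarrow> 'b) \<Rightarrow> bool" where
  "twisted_module BG m \<sigma> \<longleftrightarrow>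
     (\<forall>b. m 1 b = b) \<and>
     (\<forall>h k b.
        sw BG k (\<lambda>k1 k2. sw BG h (\<lambda>h1 h2. m h1 (m k1 b) * \<sigma> h2 k2)) =
        sw BG k (\<lambda>k1 k2. sw BG h (\<lambda>h1 h2. \<sigma> h1 k1 * m (h2 * k2) b)))"

definition crossed_product ::
    "('k \<Rightarrow> 'h::{ring,monoid_mult} \<Rightarrow> 'h) \<Rightarrow> ('k \<Rightarrow> 'b::{ring,monoid_mult} \<Rightarrow> 'b) \<Rightarrow>
     ('h, 'l) bialgebroid_data \<Rightarrow> ('l \<Rightarrow> 'b) \<Rightarrow> ('h, 'b) crossed_product_data \<Rightarrow> bool" where
  "crossed_product scH scB BG \<iota> C \<longleftrightarrow>
     measuring scH scB BG \<iota> (meas C) \<and>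
     two_cocycle scH scB BG \<iota> (meas C) (coc C) \<and>
     twisted_module BG (meas C) (coc C)"

text \<open>
  The underlying module \<open>B \<otimes>\<^sub>L H\<close> and the coaction do not depend on the measuring and the cocycle;
  only the multiplication does.
\<close>

definition clsBH ::
    "('h::{ring,monoid_mult}, 'l) bialgebroid_data \<Rightarrow> ('l \<Rightarrow> 'b::{ring,monoid_mult}) \<Rightarrow>
     ('b \<times> 'h) multiset \<Rightarrow> ('b \<times> 'h) multiset set" where
  "clsBH BG \<iota> = fs_class (tensor_rel (\<lambda>b l. b * \<iota> l) (lactH BG))"

definition clsBHH ::
    "('h::{ring,monoid_mult}, 'l) bialgebroid_data \<Rightarrow> ('l \<Rightarrow> 'b::{ring,monoid_mult}) \<Rightarrow>
     ('b \<times> 'h \<times> 'h) multiset \<Rightarrow> ('b \<times> 'h \<times> 'h) multiset set" where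
  "clsBHH BG \<iota> = fs_class (tensor3_rel (\<lambda>b l. b * \<iota> l) (lactH BG) (ractH BG) (lactH BG))"

definition cp_carrier ::
    "('h::{ring,monoid_mult}, 'l) bialgebroid_data \<Rightarrow> ('l \<Rightarrow> 'b::{ring,monoid_mult}) \<Rightarrow>
     ('b \<times> 'h) multiset set set" where
  "cp_carrier BG \<iota> = range (clsBH BG \<iota>)"

definition cp_add ::
    "('h::{ring,monoid_mult}, 'l) bialgebroid_data \<Rightarrow> ('l \<Rightarrow> 'b::{ring,monoid_mult}) \<Rightarrow>
     ('b \<times> 'h) multiset set \<Rightarrow> ('b \<times> 'h) multiset set \<Rightarrow> ('b \<times> 'h) multiset set" where
  "cp_add BG \<iota> X Y = clsBH BG \<iota> (rep X + rep Y)"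

definition cp_one ::
    "('h::{ring,monoid_mult}, 'l) bialgebroid_data \<Rightarrow> ('l \<Rightarrow> 'b::{ring,monoid_mult}) \<Rightarrow>
     ('b \<times> 'h) multiset set" where
  "cp_one BG \<iota> = clsBH BG \<iota> {#(1, 1)#}"

definition cp_mult ::
    "('h::{ring,monoid_mult}, 'l) bialgebroid_data \<Rightarrow> ('l \<Rightarrow> 'b::{ring,monoid_mult}) \<Rightarrow>
     ('h, 'b) crossed_product_data \<Rightarrow>
     ('b \<times> 'h) multiset set \<Rightarrow> ('b \<times> 'h) multiset set \<Rightarrow> ('b \<times> 'h) multiset set" where
  "cp_mult BG \<iota> C X Y =
     clsBH BG \<iota> (tsum (\<lambda>b' h'. tsum (\<lambda>b h.
       sw BG h' (\<lambda>h1' h2'. sw3 BG h (\<lambda>h1 h2 h3.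
         {#(b * meas C h1 b' * coc C h2 h1', h3 * h2')#}))) X) Y)"

definition cp_lact ::
    "('h::{ring,monoid_mult}, 'l) bialgebroid_data \<Rightarrow> ('l \<Rightarrow> 'b::{ring,monoid_mult}) \<Rightarrow>
     'b \<Rightarrow> ('b \<times> 'h) multiset set \<Rightarrow> ('b \<times> 'h) multiset set" where
  "cp_lact BG \<iota> b' X = clsBH BG \<iota> (tsum (\<lambda>b h. {#(b' * b, h)#}) X)"

definition cp_ract ::
    "('h::{ring,monoid_mult}, 'l) bialgebroid_data \<Rightarrow> ('l \<Rightarrow> 'b::{ring,monoid_mult}) \<Rightarrow>
     ('b \<times> 'h) multiset set \<Rightarrow> 'l \<Rightarrow> ('b \<times> 'h) multiset set" where
  "cp_ract BG \<iota> X l = clsBH BG \<iota> (tsum (\<lambda>b h. {#(b, ractH BG h l)#}) X)"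

definition cp_coact ::
    "('h::{ring,monoid_mult}, 'l) bialgebroid_data \<Rightarrow> ('l \<Rightarrow> 'b::{ring,monoid_mult}) \<Rightarrow>
     ('b \<times> 'h) multiset set \<Rightarrow> ('b \<times> 'h \<times> 'h) multiset set" where
  "cp_coact BG \<iota> X = clsBHH BG \<iota> (tsum (\<lambda>b h. sw BG h (\<lambda>h1 h2. {#(b, h1, h2)#})) X)"

text \<open>The map \<open>F \<otimes>\<^sub>L H\<close> on \<open>B \<otimes>\<^sub>L H \<otimes>\<^sub>L H\<close>, for a right \<open>L\<close>-linear \<open>F\<close> on \<open>B \<otimes>\<^sub>L H\<close>.\<close>

definition tensor_map_H ::
    "('h::{ring,monoid_mult}, 'l) bialgebroid_data \<Rightarrow> ('l \<Rightarrow> 'b::{ring,monoid_mult}) \<Rightarrow>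
     (('b \<times> 'h) multiset set \<Rightarrow> ('b \<times> 'h) multiset set) \<Rightarrow>
     ('b \<times> 'h \<times> 'h) multiset set \<Rightarrow> ('b \<times> 'h \<times> 'h) multiset set" where
  "tensor_map_H BG \<iota> F Z =
     clsBHH BG \<iota> (tsum3 (\<lambda>b h h'. tsum (\<lambda>b1 h1. {#(b1, h1, h')#}) (F (clsBH BG \<iota> {#(b, h)#}))) Z)"

text \<open>
  Right \<open>L\<close>-linearity is part of being a morphism of comodules over an \<open>L\<close>-coring (it makes
  \<open>F \<otimes>\<^sub>L H\<close> well defined). Linearity over the ground ring is contained in left \<open>B\<close>-linearity.
\<close>

definition cp_isomorphism ::
    "('h::{ring,monoid_mult}, 'l) bialgebroid_data \<Rightarrow> ('l \<Rightarrow> 'b::{ring,monoid_mult}) \<Rightarrow>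
     ('h, 'b) crossed_product_data \<Rightarrow> ('h, 'b) crossed_product_data \<Rightarrow>
     (('b \<times> 'h) multiset set \<Rightarrow> ('b \<times> 'h) multiset set) \<Rightarrow> bool" where
  "cp_isomorphism BG \<iota> C D F \<longleftrightarrow>
     bij_betw F (cp_carrier BG \<iota>) (cp_carrier BG \<iota>) \<and>
     (\<forall>X\<in>cp_carrier BG \<iota>. \<forall>Y\<in>cp_carrier BG \<iota>. F (cp_add BG \<iota> X Y) = cp_add BG \<iota> (F X) (F Y)) \<and>
     (\<forall>X\<in>cp_carrier BG \<iota>. \<forall>Y\<in>cp_carrier BG \<iota>.
        F (cp_mult BG \<iota> C X Y) = cp_mult BG \<iota> D (F X) (F Y)) \<and>
     F (cp_one BG \<iota>) = cp_one BG \<iota> \<and>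
     (\<forall>b. \<forall>X\<in>cp_carrier BG \<iota>. F (cp_lact BG \<iota> b X) = cp_lact BG \<iota> b (F X)) \<and>
     (\<forall>l. \<forall>X\<in>cp_carrier BG \<iota>. F (cp_ract BG \<iota> X l) = cp_ract BG \<iota> (F X) l) \<and>
     (\<forall>X\<in>cp_carrier BG \<iota>. cp_coact BG \<iota> (F X) = tensor_map_H BG \<iota> F (cp_coact BG \<iota> X))"

definition equivalent_crossed_products ::
    "('h::{ring,monoid_mult}, 'l) bialgebroid_data \<Rightarrow> ('l \<Rightarrow> 'b::{ring,monoid_mult}) \<Rightarrow>
     ('h, 'b) crossed_product_data \<Rightarrow> ('h, 'b) crossed_product_data \<Rightarrow> bool" where
  "equivalent_crossed_products BG \<iota> C D \<longleftrightarrow> (\<exists>F. cp_isomorphism BG \<iota> C D F)"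


section \<open>Gauge transforms\<close>

definition HomLL ::
    "('k \<Rightarrow> 'h::{ring,monoid_mult} \<Rightarrow> 'h) \<Rightarrow> ('k \<Rightarrow> 'b::{ring,monoid_mult} \<Rightarrow> 'b) \<Rightarrow>
     ('h, 'l) bialgebroid_data \<Rightarrow> ('l \<Rightarrow> 'b) \<Rightarrow> ('h \<Rightarrow> 'b) set" where
  "HomLL scH scB BG \<iota> =
     {\<chi>. k_linear scH scB \<chi> \<and>
         (\<forall>l l' h. \<chi> (src BG l * tgt BG l' * h) = \<iota> l * \<chi> h * \<iota> l')}"

definition conv ::
    "('h, 'l) bialgebroid_data \<Rightarrow> ('h \<Rightarrow> 'b::{ring,monoid_mult}) \<Rightarrow> ('h \<Rightarrow> 'b) \<Rightarrow> 'h \<Rightarrow> 'b" where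
  "conv BG \<chi> \<chi>' h = sw BG h (\<lambda>h1 h2. \<chi> h1 * \<chi>' h2)"

definition conv_inverse ::
    "('k \<Rightarrow> 'h::{ring,monoid_mult} \<Rightarrow> 'h) \<Rightarrow> ('k \<Rightarrow> 'b::{ring,monoid_mult} \<Rightarrow> 'b) \<Rightarrow>
     ('h, 'l) bialgebroid_data \<Rightarrow> ('l \<Rightarrow> 'b) \<Rightarrow> ('h \<Rightarrow> 'b) \<Rightarrow> ('h \<Rightarrow> 'b) \<Rightarrow> bool" where
  "conv_inverse scH scB BG \<iota> \<chi> \<chi>c \<longleftrightarrow>
     \<chi> \<in> HomLL scH scB BG \<iota> \<and> \<chi>c \<in> HomLL scH scB BG \<iota> \<and>
     conv BG \<chi> \<chi>c = \<iota> \<circ> counit BG \<and> conv BG \<chi>c \<chi> = \<iota> \<circ> counit BG"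

definition gauge_meas ::
    "('h, 'l) bialgebroid_data \<Rightarrow> ('h \<Rightarrow> 'b::{ring,monoid_mult}) \<Rightarrow> ('h \<Rightarrow> 'b) \<Rightarrow>
     ('h \<Rightarrow> 'b \<Rightarrow> 'b) \<Rightarrow> 'h \<Rightarrow> 'b \<Rightarrow> 'b" where
  "gauge_meas BG \<chi> \<chi>c m h b = sw3 BG h (\<lambda>h1 h2 h3. \<chi> h1 * m h2 b * \<chi>c h3)"

definition gauge_coc ::
    "('h::{ring,monoid_mult}, 'l) bialgebroid_data \<Rightarrow>
     ('h \<Rightarrow> 'b::{ring,monoid_mult}) \<Rightarrow> ('h \<Rightarrow> 'b) \<Rightarrow>
     ('h \<Rightarrow> 'b \<Rightarrow> 'b) \<Rightarrow> ('h \<Rightarrow> 'h \<Rightarrow> 'b) \<Rightarrow> 'h \<Rightarrow> 'h \<Rightarrow> 'b" where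
  "gauge_coc BG \<chi> \<chi>c m \<sigma> h k =
     sw3 BG k (\<lambda>k1 k2 k3. sw4 BG h (\<lambda>h1 h2 h3 h4.
       \<chi> h1 * m h2 (\<chi> k1) * \<sigma> h3 k2 * \<chi>c (h4 * k3)))"

text \<open>A crossed product is identified with its pair of measuring and cocycle.\<close>

definition gauge_transform ::
    "('h::{ring,monoid_mult}, 'l) bialgebroid_data \<Rightarrow>
     ('h \<Rightarrow> 'b::{ring,monoid_mult}) \<Rightarrow> ('h \<Rightarrow> 'b) \<Rightarrow>
     ('h, 'b) crossed_product_data \<Rightarrow> ('h, 'b) crossed_product_data" where
  "gauge_transform BG \<chi> \<chi>c C =
     \<lparr> meas = gauge_meas BG \<chi> \<chi>c (meas C), coc = gauge_coc BG \<chi> \<chi>c (meas C) (coc C) \<rparr>"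

definition is_gauge_transform_of ::
    "('k \<Rightarrow> 'h::{ring,monoid_mult} \<Rightarrow> 'h) \<Rightarrow> ('k \<Rightarrow> 'b::{ring,monoid_mult} \<Rightarrow> 'b) \<Rightarrow>
     ('h, 'l) bialgebroid_data \<Rightarrow> ('l \<Rightarrow> 'b) \<Rightarrow>
     ('h, 'b) crossed_product_data \<Rightarrow> ('h, 'b) crossed_product_data \<Rightarrow> bool" where
  "is_gauge_transform_of scH scB BG \<iota> D C \<longleftrightarrow>
     (\<exists>\<chi> \<chi>c. conv_inverse scH scB BG \<iota> \<chi> \<chi>c \<and> \<chi> 1 = 1 \<and> D = gauge_transform BG \<chi> \<chi>c C)"

end

theory Submission
  imports Defs
begin

text \<open>
  A left \<open>B\<close>-linear, right \<open>L\<close>-linear, colinear endomorphism of \<open>B \<otimes> H\<close> over \<open>L\<close> is of the form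
  \<open>b \<otimes> h \<mapsto> b \<chi>(h\<^sub>1) \<otimes> h\<^sub>2\<close> for a unique \<open>\<chi>\<close> in \<open>Hom\<^sub>L\<^sub>,\<^sub>L(H, B)\<close>, namely \<open>h \<mapsto> (B \<otimes> \<pi>)(F(1 \<otimes> h))\<close>, and
  composition of such maps corresponds to convolution. So bijectivity is convolution invertibility.
  For fixed \<open>b\<close> and \<open>k\<close>, the maps \<open>h \<mapsto> h\<cdot>b\<close>, \<open>h \<mapsto> \<sigma>(h, k)\<close> and \<open>h \<mapsto> \<chi>(hk)\<close> lie in \<open>Hom\<^sub>L\<^sub>,\<^sub>L(H, B)\<close> too;
  applying \<open>B \<otimes> \<pi>\<close> to the multiplicativity of the map given by \<open>\<chi>\<close> turns it into an identity in the
  convolution algebra, which splits into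
  \<open>(h\<^sub>1 \<cdot>' b) \<chi>(h\<^sub>2) = \<chi>(h\<^sub>1) (h\<^sub>2 \<cdot> b)\<close> and
  \<open>\<sigma>'(h\<^sub>1, k\<^sub>1) \<chi>(h\<^sub>2 k\<^sub>2) = \<chi>(h\<^sub>1) (h\<^sub>2 \<cdot> \<chi>(k\<^sub>1)) \<sigma>(h\<^sub>3, k\<^sub>2)\<close>, and solving for \<open>\<cdot>'\<close> and \<open>\<sigma>'\<close> by convolving with
  the inverse of \<open>\<chi>\<close> gives the gauge transform.
\<close>

section \<open>Additive quotients and balanced maps\<close>

text \<open>
  Identities in a quotient are stated as \<open>q x = q y\<close>, with \<open>q\<close> the class map of a tensor product or
  the identity of an abelian group, so that one set of rules for Sweedler sums covers both.
\<close>

locale additive_quotient =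
  fixes q :: "'m::comm_monoid_add \<Rightarrow> 'q"
  assumes cancel: "q (x + z) = q (y + z) \<longleftrightarrow> q x = q y"
begin

lemma cong_add: "q x = q x' \<Longrightarrow> q y = q y' \<Longrightarrow> q (x + y) = q (x' + y')"
  by (metis add.commute cancel)

lemma cong_sum:
  assumes "\<And>x. x \<in># X \<Longrightarrow> q (f x) = q (g x)"
  shows "q (\<Sum>x\<in>#X. f x) = q (\<Sum>x\<in>#X. g x)"
  using assms by (induction X) (auto intro: cong_add)

text \<open>Stands in for subtraction, which formal sums do not have. Applied to
  \<open>f (0 + 0)\<close>, it shows that maps which are additive modulo \<open>q\<close> send zero
  to zero modulo \<open>q\<close>.\<close>

lemma zero_if_double: "q x = q (x + x) \<Longrightarrow> q x = q 0"
  by (metis add.left_neutral cancel)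

end

lemma additive_quotient_id: "additive_quotient (\<lambda>x::'m::ab_group_add. x)"
  by unfold_locales simp

section \<open>Tensor products as cancellative quotients of formal sums\<close>

lemma fs_class_eq_iff: "fs_class R x = fs_class R y \<longleftrightarrow> fs_cong R x y"
  unfolding fs_class_def by (auto intro: fs_cong.refl fs_cong.sym fs_cong.trans)

lemma fs_cong_rep: "fs_cong R x (rep (fs_class R x))"
proof -
  have "x \<in> fs_class R x"
    by (simp add: fs_class_def fs_cong.refl)
  then have "rep (fs_class R x) \<in> fs_class R x"
    unfolding rep_def by (rule someI)
  then show ?thesis
    by (simp add: fs_class_def)
qed

lemma fs_class_rep [simp]: "fs_class R (rep (fs_class R x)) = fs_class R x"
  using fs_cong_rep[of R x] by (simp add: fs_class_eq_iff fs_cong.sym)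

lemma fs_cong_add: "fs_cong R x x' \<Longrightarrow> fs_cong R y y' \<Longrightarrow> fs_cong R (x + y) (x' + y')"
  by (metis add.commute fs_cong.add fs_cong.trans)

text \<open>Formal sums form only a monoid, so cancellation has to come from inverses modulo the
  congruence. Inverses of single generators suffice, because they add up to an inverse of any formal
  sum.\<close>

lemma additive_quotient_fs_class:
  assumes "\<And>g. \<exists>z. fs_cong R ({#g#} + z) {#}"
  shows "additive_quotient (fs_class R)"
proof
  fix x y z :: "'a multiset"
  have inverse: "\<exists>z'. fs_cong R (z + z') {#}" for z
  proof (induction z)
    case empty
    then show ?case by (auto intro: exI[of _ "{#}"] fs_cong.refl)
  next
    case (add g z)
    then obtain z' where "fs_cong R (z + z') {#}" by blast
    moreover obtain w where "fs_cong R ({#g#} + w) {#}" using assms by blast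
    ultimately have "fs_cong R (z + z' + ({#g#} + w)) ({#} + {#})"
      by (rule fs_cong_add)
    then show ?case
      by (intro exI[of _ "z' + w"]) (simp add: ac_simps)
  qed
  then obtain z' where z': "fs_cong R (z + z') {#}" by blast
  show "fs_class R (x + z) = fs_class R (y + z) \<longleftrightarrow> fs_class R x = fs_class R y"
  proof
    assume "fs_class R (x + z) = fs_class R (y + z)"
    then have "fs_cong R (x + z + z') (y + z + z')"
      by (simp add: fs_class_eq_iff fs_cong.add)
    moreover have "fs_cong R (x + (z + z')) (x + {#})" "fs_cong R (y + (z + z')) (y + {#})"
      by (intro fs_cong_add fs_cong.refl z')+
    ultimately show "fs_class R x = fs_class R y"
      by (auto simp: fs_class_eq_iff add.assoc intro: fs_cong.sym fs_cong.trans)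
  qed (simp add: fs_class_eq_iff fs_cong.add)
qed

text \<open>Universal property of the quotient. In the induction over the congruence, compatibility
  with \<open>R\<close> settles the base case and \<open>cancel\<close> the closure under
  addition.\<close>

lemma (in additive_quotient) sum_fs_class:
  assumes "\<And>x y. R x y \<Longrightarrow> q (\<Sum>g\<in>#x. f g) = q (\<Sum>g\<in>#y. f g)"
    and "fs_class R x = fs_class R y"
  shows "q (\<Sum>g\<in>#x. f g) = q (\<Sum>g\<in>#y. f g)"
proof -
  have "fs_cong R x y"
    using assms(2) by (simp add: fs_class_eq_iff)
  then show ?thesis
    by (induction rule: fs_cong.induct) (simp_all add: assms(1) cancel)
qed

text \<open>The equations are required only modulo \<open>q\<close>, since the map from
  \<open>(a, b)\<close> to the formal sum \<open>{#(a, b)#}\<close> is biadditive only in the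
  quotient. The relations of \<open>tensor_rel\<close> that involve zero follow by
  \<open>zero_if_double\<close>.\<close>

definition balanced ::
    "('m \<Rightarrow> 'q) \<Rightarrow> ('a::ab_group_add \<Rightarrow> 'l \<Rightarrow> 'a) \<Rightarrow> ('l \<Rightarrow> 'b::ab_group_add \<Rightarrow> 'b) \<Rightarrow>
     ('a \<Rightarrow> 'b \<Rightarrow> 'm::comm_monoid_add) \<Rightarrow> bool" where
  "balanced q ra lb f \<longleftrightarrow>
     (\<forall>a a' b. q (f (a + a') b) = q (f a b + f a' b)) \<and>
     (\<forall>a b b'. q (f a (b + b')) = q (f a b + f a b')) \<and>
     (\<forall>a l b. q (f (ra a l) b) = q (f a (lb l b)))"

definition balanced3 ::
    "('m \<Rightarrow> 'q) \<Rightarrow> ('a::ab_group_add \<Rightarrow> 'l \<Rightarrow> 'a) \<Rightarrow> ('l \<Rightarrow> 'b::ab_group_add \<Rightarrow> 'b) \<Rightarrow>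
     ('b \<Rightarrow> 'l \<Rightarrow> 'b) \<Rightarrow> ('l \<Rightarrow> 'c::ab_group_add \<Rightarrow> 'c) \<Rightarrow>
     ('a \<Rightarrow> 'b \<Rightarrow> 'c \<Rightarrow> 'm::comm_monoid_add) \<Rightarrow> bool" where
  "balanced3 q ra lb rb lc f \<longleftrightarrow>
     (\<forall>a a' b c. q (f (a + a') b c) = q (f a b c + f a' b c)) \<and>
     (\<forall>a b b' c. q (f a (b + b') c) = q (f a b c + f a b' c)) \<and>
     (\<forall>a b c c'. q (f a b (c + c')) = q (f a b c + f a b c')) \<and>
     (\<forall>a l b c. q (f (ra a l) b c) = q (f a (lb l b) c)) \<and>
     (\<forall>a b l c. q (f a (rb b l) c) = q (f a b (lc l c)))"

lemma balancedI:
  assumes "\<And>a a' b. q (f (a + a') b) = q (f a b + f a' b)"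
    and "\<And>a b b'. q (f a (b + b')) = q (f a b + f a b')"
    and "\<And>a l b. q (f (ra a l) b) = q (f a (lb l b))"
  shows "balanced q ra lb f"
  using assms by (simp add: balanced_def)

lemma balanced3I:
  assumes "\<And>a a' b c. q (f (a + a') b c) = q (f a b c + f a' b c)"
    and "\<And>a b b' c. q (f a (b + b') c) = q (f a b c + f a b' c)"
    and "\<And>a b c c'. q (f a b (c + c')) = q (f a b c + f a b c')"
    and "\<And>a l b c. q (f (ra a l) b c) = q (f a (lb l b) c)"
    and "\<And>a b l c. q (f a (rb b l) c) = q (f a b (lc l c))"
  shows "balanced3 q ra lb rb lc f"
  using assms by (simp add: balanced3_def)

context additive_quotient
begin

lemma sum_tensor:
  assumes f: "balanced q ra lb f"
    and eq: "fs_class (tensor_rel ra lb) x = fs_class (tensor_rel ra lb) y"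
  shows "q (\<Sum>(a, b)\<in>#x. f a b) = q (\<Sum>(a, b)\<in>#y. f a b)"
proof (rule sum_fs_class[OF _ eq])
  have "q (f 0 b) = q 0" "q (f a 0) = q 0" for a b
    using f by (auto simp: balanced_def intro!: zero_if_double, metis add_0, metis add_0)
  note zero = this
  fix x y assume "tensor_rel ra lb x y"
  then show "q (\<Sum>(a, b)\<in>#x. f a b) = q (\<Sum>(a, b)\<in>#y. f a b)"
    by cases (use f zero in \<open>simp_all add: balanced_def add.commute\<close>)
qed

lemma sum_tensor3:
  assumes f: "balanced3 q ra lb rb lc f"
    and eq: "fs_class (tensor3_rel ra lb rb lc) x = fs_class (tensor3_rel ra lb rb lc) y"
  shows "q (\<Sum>(a, b, c)\<in>#x. f a b c) = q (\<Sum>(a, b, c)\<in>#y. f a b c)"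
proof (rule sum_fs_class[OF _ eq])
  have "q (f 0 b c) = q 0" "q (f a 0 c) = q 0" "q (f a b 0) = q 0" for a b c
    using f by (auto simp: balanced3_def intro!: zero_if_double, (metis add_0)+)
  note zero = this
  fix x y assume "tensor3_rel ra lb rb lc x y"
  then show "q (\<Sum>(a, b, c)\<in>#x. f a b c) = q (\<Sum>(a, b, c)\<in>#y. f a b c)"
    by cases (use f zero in \<open>simp_all add: balanced3_def add.commute\<close>)
qed

end

text \<open>The inverse of \<open>a \<otimes> b\<close> is \<open>(- a) \<otimes> b\<close>, since
  the two add up to \<open>0 \<otimes> b\<close>.\<close>

lemma additive_quotient_tensor: "additive_quotient (fs_class (tensor_rel ra lb))"
proof (rule additive_quotient_fs_class)
  fix g :: "'a \<times> 'b"
  obtain a b where g: "g = (a, b)" by fastforce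
  have "fs_cong (tensor_rel ra lb) {#(a + - a, b)#} {#(a, b), (- a, b)#}"
    by (intro fs_cong.base tensor_rel.intros)
  moreover have "fs_cong (tensor_rel ra lb) {#(a + - a, b)#} {#}"
    by (simp, intro fs_cong.base tensor_rel.intros)
  ultimately have "fs_cong (tensor_rel ra lb) {#(a, b), (- a, b)#} {#}"
    by (blast intro: fs_cong.sym fs_cong.trans)
  moreover have "{#(a, b), (- a, b)#} = {#g#} + {#(- a, b)#}"
    by (simp add: g)
  ultimately show "\<exists>z. fs_cong (tensor_rel ra lb) ({#g#} + z) {#}"
    by metis
qed

lemma additive_quotient_tensor3: "additive_quotient (fs_class (tensor3_rel ra lb rb lc))"
proof (rule additive_quotient_fs_class)
  fix g :: "'a \<times> 'b \<times> 'c"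
  obtain a b c where g: "g = (a, b, c)" by (cases g) auto
  have "fs_cong (tensor3_rel ra lb rb lc) {#(a + - a, b, c)#} {#(a, b, c), (- a, b, c)#}"
    by (intro fs_cong.base tensor3_rel.intros)
  moreover have "fs_cong (tensor3_rel ra lb rb lc) {#(a + - a, b, c)#} {#}"
    by (simp, intro fs_cong.base tensor3_rel.intros)
  ultimately have "fs_cong (tensor3_rel ra lb rb lc) {#(a, b, c), (- a, b, c)#} {#}"
    by (blast intro: fs_cong.sym fs_cong.trans)
  moreover have "{#(a, b, c), (- a, b, c)#} = {#g#} + {#(- a, b, c)#}"
    by (simp add: g)
  ultimately show "\<exists>z. fs_cong (tensor3_rel ra lb rb lc) ({#g#} + z) {#}"
    by metis
qed

lemma balanced_tensor:
  "balanced (fs_class (tensor_rel ra lb)) ra lb (\<lambda>a b. {#(a, b)#})"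
  using tensor_rel.intros[of ra lb, THEN fs_cong.base[of "tensor_rel ra lb"]]
  by (simp add: balanced_def fs_class_eq_iff add_mset_commute)

lemma balanced3_tensor3:
  "balanced3 (fs_class (tensor3_rel ra lb rb lc)) ra lb rb lc (\<lambda>a b c. {#(a, b, c)#})"
  using tensor3_rel.intros[of ra lb rb lc, THEN fs_cong.base[of "tensor3_rel ra lb rb lc"]]
  by (simp add: balanced3_def fs_class_eq_iff add_mset_commute)


section \<open>Sweedler sums\<close>

text \<open>\<open>sw\<close> is a finite sum over one fixed representative of
  \<open>comul BG h\<close>. Hence this rule, like the following ones on products, sums and swaps,
  is a strict equality that asks for no balancedness.\<close>

lemma sw_hom:
  assumes "\<phi> 0 = 0" "\<And>x y. \<phi> (x + y) = \<phi> x + \<phi> y"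
  shows "\<phi> (sw BG h f) = sw BG h (\<lambda>a b. \<phi> (f a b))"
proof -
  have "\<phi> (\<Sum>(a, b)\<in>#X. f a b) = (\<Sum>(a, b)\<in>#X. \<phi> (f a b))" for X
    using assms by (induction X) auto
  then show ?thesis
    by (simp add: sw_def tsum_def)
qed

lemma sw_mult_left: "c * sw BG h f = sw BG h (\<lambda>a b. c * f a b)" for c :: "'b::ring"
  by (rule sw_hom) (simp_all add: distrib_left)

lemma sw_mult_right: "sw BG h f * c = sw BG h (\<lambda>a b. f a b * c)" for c :: "'b::ring"
  by (rule sw_hom[where \<phi> = "\<lambda>x. x * c"]) (simp_all add: distrib_right)

lemma sw_sum_mset:
  "(\<Sum>g\<in>#sw BG h f. \<phi> g) = sw BG h (\<lambda>a b. \<Sum>g\<in>#f a b. \<phi> g)"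
  by (rule sw_hom[where \<phi> = "\<lambda>X. \<Sum>g\<in>#X. \<phi> g"]) simp_all

lemma sw_plus: "sw BG h (\<lambda>a b. f a b + g a b) = sw BG h f + sw BG h g"
  by (simp add: sw_def tsum_def case_prod_unfold sum_mset.distrib)

lemma sw_swap:
  "sw BG h (\<lambda>a b. sw BG k (\<lambda>c d. f a b c d)) = sw BG k (\<lambda>c d. sw BG h (\<lambda>a b. f a b c d))"
  unfolding sw_def tsum_def case_prod_unfold by (rule sum_mset.swap)

lemma (in additive_quotient) sw_cong:
  "(\<And>a b. q (f a b) = q (g a b)) \<Longrightarrow> q (sw BG h f) = q (sw BG h g)"
  unfolding sw_def tsum_def by (rule cong_sum) auto

text \<open>Serves maps such as the one from \<open>b\<close> to \<open>{#(b, h)#}\<close>, which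
  become additive only after \<open>q\<close> is applied.\<close>

lemma (in additive_quotient) sw_hom_mod:
  assumes "q (\<phi> 0) = q 0" "\<And>x y. q (\<phi> (x + y)) = q (\<phi> x + \<phi> y)"
  shows "q (\<phi> (sw BG h f)) = q (sw BG h (\<lambda>a b. \<phi> (f a b)))"
proof -
  have "q (\<phi> (\<Sum>(a, b)\<in>#X. f a b)) = q (\<Sum>(a, b)\<in>#X. \<phi> (f a b))" for X
    by (induction X) (auto simp: assms intro!: cong_add)
  then show ?thesis
    by (simp add: sw_def tsum_def)
qed

abbreviation balancedH ::
    "('h::{ring,monoid_mult}, 'l) bialgebroid_data \<Rightarrow> ('m \<Rightarrow> 'q) \<Rightarrow>
     ('h \<Rightarrow> 'h \<Rightarrow> 'm::comm_monoid_add) \<Rightarrow> bool" where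
  "balancedH BG q \<equiv> balanced q (ractH BG) (lactH BG)"

abbreviation balanced3H ::
    "('h::{ring,monoid_mult}, 'l) bialgebroid_data \<Rightarrow> ('m \<Rightarrow> 'q) \<Rightarrow>
     ('h \<Rightarrow> 'h \<Rightarrow> 'h \<Rightarrow> 'm::comm_monoid_add) \<Rightarrow> bool" where
  "balanced3H BG q \<equiv> balanced3 q (ractH BG) (lactH BG) (ractH BG) (lactH BG)"

section \<open>The bialgebroid axioms as rules for Sweedler sums\<close>

context left_bialgebroid
begin

lemma src_1: "src BG 1 = 1" and tgt_1: "tgt BG 1 = 1"
  using src_algebra_map tgt_algebra_map by (auto simp: algebra_map_def algebra_antimap_def)

lemma src_scale: "src BG (scL c l) = scH c (src BG l)"
  using src_algebra_map by (auto simp: algebra_map_def k_linear_def)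

text \<open>The ground ring acts on \<open>H\<close> through \<open>L\<close>; in
  \<open>HomI\<close> this reduces linearity over the ground ring to linearity over
  \<open>L\<close>.\<close>

lemma scH_eq_src: "scH c h = src BG (scL c 1) * h"
  by (simp add: src_scale src_1 H.scale_mult_left)

lemma counit_src: "counit BG (src BG l * h) = l * counit BG h"
  using counit_bimodule[of l 1 h] by (simp add: tgt_1)

lemma counit_tgt: "counit BG (tgt BG l * h) = counit BG h * l"
  using counit_bimodule[of 1 l h] by (simp add: src_1)

context
  fixes q :: "'m::comm_monoid_add \<Rightarrow> 'q"
  assumes q: "additive_quotient q"
begin

interpretation additive_quotient q by (fact q)

text \<open>Frees a Sweedler sum with balanced summand from the chosen representative. Each axiom
  that computes a value of \<open>comul\<close> thereby becomes a rewrite rule.\<close>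

lemma sw_class:
  assumes "balancedH BG q f" "comul BG h = clsHH BG x"
  shows "q (sw BG h f) = q (\<Sum>(a, b)\<in>#x. f a b)"
  unfolding sw_def tsum_def
  by (rule sum_tensor[OF assms(1)]) (simp add: assms(2) clsHH_def)

lemma sw_add:
  assumes "balancedH BG q f"
  shows "q (sw BG (h + h') f) = q (sw BG h f + sw BG h' f)"
  using sw_class[OF assms comul_add] by (simp add: sw_def tsum_def)

lemma sw_bimodule:
  assumes "balancedH BG q f"
  shows "q (sw BG (src BG l * tgt BG l' * h) f) =
    q (sw BG h (\<lambda>a b. f (src BG l * a) (tgt BG l' * b)))"
  using sw_class[OF assms comul_bimodule] by (simp add: sw_sum_mset)

lemma sw_src:
  "balancedH BG q f \<Longrightarrow> q (sw BG (src BG l * h) f) = q (sw BG h (\<lambda>a b. f (src BG l * a) b))"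
  using sw_bimodule[of f l 1 h] by (simp add: tgt_1)

lemma sw_tgt:
  "balancedH BG q f \<Longrightarrow> q (sw BG (tgt BG l * h) f) = q (sw BG h (\<lambda>a b. f a (tgt BG l * b)))"
  using sw_bimodule[of f 1 l h] by (simp add: src_1)

lemma sw_one: "balancedH BG q f \<Longrightarrow> q (sw BG 1 f) = q (f 1 1)"
  using sw_class[OF _ comul_one] by simp

lemma sw_mult:
  assumes "balancedH BG q f"
  shows "q (sw BG (h * h') f) =
    q (sw BG h' (\<lambda>a' b'. sw BG h (\<lambda>a b. f (a * a') (b * b'))))"
  using sw_class[OF assms comul_mult] by (simp add: sw_sum_mset)

lemma sw_takeuchi:
  assumes "balancedH BG q f"
  shows "q (sw BG h (\<lambda>a b. f (a * tgt BG l) b)) = q (sw BG h (\<lambda>a b. f a (b * src BG l)))"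
  using sum_tensor[OF assms takeuchi[unfolded clsHH_def]] by (simp add: sw_sum_mset)

lemma sw_coassoc:
  assumes "balanced3H BG q f"
  shows "q (sw BG h (\<lambda>h1 h2. sw BG h1 (\<lambda>a b. f a b h2))) =
    q (sw BG h (\<lambda>h1 h2. sw BG h2 (\<lambda>a b. f h1 a b)))"
  using sum_tensor3[OF assms coassoc[unfolded clsHHH_def]] by (simp add: sw_sum_mset)

lemma balanced_mult_right:
  assumes "balancedH BG q f"
  shows "balancedH BG q (\<lambda>a b. f (a * c) (b * d))"
  using assms by (simp add: balanced_def ractH_def lactH_def distrib_right mult.assoc)

text \<open>The Takeuchi axiom is what makes \<open>h1 a' \<otimes> h2 b'\<close> balanced in
  \<open>a'\<close> and \<open>b'\<close>.\<close>

lemma balanced_sw_mult: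
  assumes "balancedH BG q f"
  shows "balancedH BG q (\<lambda>a' b'. sw BG h (\<lambda>a b. f (a * a') (b * b')))"
proof (rule balancedI)
  fix a a' b l
  show "q (sw BG h (\<lambda>x y. f (x * (a + a')) (y * b))) =
      q (sw BG h (\<lambda>x y. f (x * a) (y * b)) + sw BG h (\<lambda>x y. f (x * a') (y * b)))"
    using assms unfolding sw_plus[symmetric]
    by (intro sw_cong) (simp add: balanced_def distrib_left)
  show "q (sw BG h (\<lambda>x y. f (x * b) (y * (a + a')))) =
      q (sw BG h (\<lambda>x y. f (x * b) (y * a)) + sw BG h (\<lambda>x y. f (x * b) (y * a')))"
    using assms unfolding sw_plus[symmetric]
    by (intro sw_cong) (simp add: balanced_def distrib_left)
  show "q (sw BG h (\<lambda>x y. f (x * ractH BG a l) (y * b))) =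
      q (sw BG h (\<lambda>x y. f (x * a) (y * lactH BG l b)))"
    using sw_takeuchi[OF balanced_mult_right[OF assms], of h l a b]
    by (simp add: ractH_def lactH_def mult.assoc)
qed

text \<open>Comes from multiplicativity of the coproduct, with \<open>tgt BG l * 1\<close> as the
  right factor, and from its value at 1.\<close>

lemma sw_mult_tgt:
  assumes "balancedH BG q f"
  shows "q (sw BG (h * tgt BG l) f) = q (sw BG h (\<lambda>a b. f a (b * tgt BG l)))"
proof -
  let ?g = "\<lambda>a' b'. sw BG h (\<lambda>a b. f (a * a') (b * b'))"
  note bal = balanced_sw_mult[OF assms, of h]
  \<comment> \<open>Evaluation at 1 by \<open>sw_one\<close> requires the shifted summand to be
    balanced. This rests on the commuting images of \<open>src\<close> and
    \<open>tgt\<close>.\<close>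
  have "balancedH BG q (\<lambda>a b. ?g a (tgt BG l * b))"
  proof (rule balancedI)
    fix a l' b
    have "q (?g (tgt BG l' * a) (tgt BG l * b)) = q (?g a (src BG l' * (tgt BG l * b)))"
      using bal by (simp only: balanced_def ractH_def lactH_def)
    also have "src BG l' * (tgt BG l * b) = tgt BG l * (src BG l' * b)"
      by (simp only: mult.assoc[symmetric] src_tgt_commute)
    finally show "q (?g (ractH BG a l') (tgt BG l * b)) = q (?g a (tgt BG l * lactH BG l' b))"
      by (simp only: ractH_def lactH_def)
  qed (use bal in \<open>simp_all only: balanced_def distrib_left\<close>)
  then have "q (sw BG (tgt BG l * 1) ?g) = q (?g 1 (tgt BG l * 1))"
    by (simp only: sw_tgt[OF bal] sw_one)
  then show ?thesis
    by (simp add: sw_mult[OF assms])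
qed

end

end

section \<open>The convolution algebra\<close>

lemma conv_add_left: "conv BG (\<lambda>h. x h + x' h) y h = conv BG x y h + conv BG x' y h"
  by (simp add: conv_def distrib_right sw_plus)

lemma conv_add_right: "conv BG x (\<lambda>h. y h + y' h) h = conv BG x y h + conv BG x y' h"
  by (simp add: conv_def distrib_left sw_plus)

lemma conv_sw_left:
  "conv BG (\<lambda>h. sw BG k (\<lambda>a b. f a b h)) y h = sw BG k (\<lambda>a b. conv BG (f a b) y h)"
  by (simp add: conv_def sw_mult_right) (rule sw_swap)

lemma conv_sw_right:
  "conv BG x (\<lambda>h. sw BG k (\<lambda>a b. f a b h)) h = sw BG k (\<lambda>a b. conv BG x (f a b) h)"
  by (simp add: conv_def sw_mult_left) (rule sw_swap)

locale bialgebroid_with_ring =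
  left_bialgebroid scH scL BG + L_ring scL scB \<iota>
  for scH :: "'k::{comm_ring,comm_monoid_mult} \<Rightarrow> 'h::{ring,monoid_mult} \<Rightarrow> 'h"
    and scL :: "'k \<Rightarrow> 'l::{ring,monoid_mult} \<Rightarrow> 'l"
    and scB :: "'k \<Rightarrow> 'b::{ring,monoid_mult} \<Rightarrow> 'b"
    and BG :: "('h, 'l) bialgebroid_data"
    and \<iota> :: "'l \<Rightarrow> 'b"
begin

abbreviation Hom :: "('h \<Rightarrow> 'b) set" where
  "Hom \<equiv> HomLL scH scB BG \<iota>"

abbreviation convolution :: "('h \<Rightarrow> 'b) \<Rightarrow> ('h \<Rightarrow> 'b) \<Rightarrow> 'h \<Rightarrow> 'b"  (infixr "\<diamondop>" 70) where
  "x \<diamondop> y \<equiv> conv BG x y"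

lemma iota_1 [simp]: "\<iota> 1 = 1" and iota_mult: "\<iota> (l * l') = \<iota> l * \<iota> l'"
  and iota_add: "\<iota> (l + l') = \<iota> l + \<iota> l'" and iota_scale: "\<iota> (scL c l) = scB c (\<iota> l)"
  using algebra_map by (auto simp: algebra_map_def k_linear_def)

lemma HomI:
  assumes "\<And>h h'. x (h + h') = x h + x h'"
    and "\<And>l h. x (src BG l * h) = \<iota> l * x h" "\<And>l h. x (tgt BG l * h) = x h * \<iota> l"
  shows "x \<in> Hom"
  using assms
  by (simp add: HomLL_def k_linear_def scH_eq_src iota_scale B.scale_mult_left mult.assoc)

lemma Hom_add: "x \<in> Hom \<Longrightarrow> x (h + h') = x h + x h'"
  by (simp add: HomLL_def k_linear_def)

lemma Hom_src: "x \<in> Hom \<Longrightarrow> x (src BG l * h) = \<iota> l * x h"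
  by (simp add: HomLL_def) (metis iota_1 mult_1_left mult_1_right tgt_1)

lemma Hom_tgt: "x \<in> Hom \<Longrightarrow> x (tgt BG l * h) = x h * \<iota> l"
  by (simp add: HomLL_def) (metis iota_1 mult_1_left src_1)

lemma Hom_zero: "x \<in> Hom \<Longrightarrow> x 0 = 0"
  by (metis Hom_add add_cancel_right_right)

lemma Hom_counit: "\<iota> \<circ> counit BG \<in> Hom"
  by (rule HomI) (simp_all add: counit_add counit_src counit_tgt iota_add iota_mult)

lemma Hom_mult_right: "x \<in> Hom \<Longrightarrow> (\<lambda>h. x (h * c)) \<in> Hom"
  by (rule HomI) (simp_all add: Hom_add Hom_src Hom_tgt distrib_right mult.assoc)

lemma Hom_sw: "(\<And>a b. f a b \<in> Hom) \<Longrightarrow> (\<lambda>h. sw BG k (\<lambda>a b. f a b h)) \<in> Hom"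
  by (rule HomI) (simp_all add: Hom_add Hom_src Hom_tgt sw_plus sw_mult_left sw_mult_right)

lemmas swB_add = sw_add[OF additive_quotient_id]
lemmas swB_src = sw_src[OF additive_quotient_id]
lemmas swB_tgt = sw_tgt[OF additive_quotient_id]
lemmas swB_one = sw_one[OF additive_quotient_id]
lemmas swB_mult = sw_mult[OF additive_quotient_id]
lemmas swB_takeuchi = sw_takeuchi[OF additive_quotient_id]
lemmas swB_coassoc = sw_coassoc[OF additive_quotient_id]
lemmas swB_mult_tgt = sw_mult_tgt[OF additive_quotient_id]

lemma balanced_conv:
  assumes "x \<in> Hom" "y \<in> Hom"
  shows "balancedH BG (\<lambda>x. x) (\<lambda>a b. x a * y b)"
  by (rule balancedI) (simp_all add: assms Hom_add Hom_src Hom_tgt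
      distrib_left distrib_right ractH_def lactH_def mult.assoc)

lemma conv_in_Hom:
  assumes "x \<in> Hom" "y \<in> Hom"
  shows "x \<diamondop> y \<in> Hom"
  unfolding conv_def
  by (rule HomI) (simp_all add: swB_add swB_src swB_tgt balanced_conv assms Hom_src Hom_tgt
      sw_mult_left sw_mult_right mult.assoc)

lemma conv_assoc:
  assumes "x \<in> Hom" "y \<in> Hom" "z \<in> Hom"
  shows "(x \<diamondop> y) \<diamondop> z = x \<diamondop> y \<diamondop> z"
proof
  fix h
  have "balanced3H BG (\<lambda>x. x) (\<lambda>a b c. x a * y b * z c)"
    by (rule balanced3I) (simp_all add: assms Hom_add Hom_src Hom_tgt
        distrib_left distrib_right ractH_def lactH_def mult.assoc)
  from swB_coassoc[OF this, of h] show "((x \<diamondop> y) \<diamondop> z) h = (x \<diamondop> y \<diamondop> z) h"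
    by (simp add: conv_def sw_mult_left sw_mult_right mult.assoc)
qed

lemma Hom_sw_arg: "x \<in> Hom \<Longrightarrow> x (sw BG k f) = sw BG k (\<lambda>a b. x (f a b))"
  by (rule sw_hom) (simp_all add: Hom_zero Hom_add)

lemma conv_unit_left:
  assumes "x \<in> Hom"
  shows "(\<iota> \<circ> counit BG) \<diamondop> x = x"
proof
  fix h
  have "((\<iota> \<circ> counit BG) \<diamondop> x) h = sw BG h (\<lambda>a b. x (src BG (counit BG a) * b))"
    by (simp add: conv_def Hom_src[OF assms])
  also have "\<dots> = x h"
    by (simp only: Hom_sw_arg[OF assms, symmetric] counit_left)
  finally show "((\<iota> \<circ> counit BG) \<diamondop> x) h = x h" .
qed

lemma conv_unit_right:
  assumes "x \<in> Hom"
  shows "x \<diamondop> (\<iota> \<circ> counit BG) = x"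
proof
  fix h
  have "(x \<diamondop> (\<iota> \<circ> counit BG)) h = sw BG h (\<lambda>a b. x (tgt BG (counit BG b) * a))"
    by (simp add: conv_def Hom_tgt[OF assms])
  also have "\<dots> = x h"
    by (simp only: Hom_sw_arg[OF assms, symmetric] counit_right)
  finally show "(x \<diamondop> (\<iota> \<circ> counit BG)) h = x h" .
qed

text \<open>The Takeuchi axiom in the convolution algebra. It serves to move elements of
  \<open>L\<close> between the components of a second element \<open>k\<close> that are multiplied
  to those of \<open>h\<close> from the right.\<close>

lemma conv_takeuchi:
  assumes "x \<in> Hom" "y \<in> Hom"
  shows "((\<lambda>h. x (h * tgt BG l)) \<diamondop> y) h = (x \<diamondop> (\<lambda>h. y (h * src BG l))) h"
  using swB_takeuchi[OF balanced_conv[OF assms]] by (simp add: conv_def)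

lemma conv_mult_tgt:
  assumes "x \<in> Hom" "y \<in> Hom"
  shows "(x \<diamondop> y) (h * tgt BG l) = (x \<diamondop> (\<lambda>h. y (h * tgt BG l))) h"
  using swB_mult_tgt[OF balanced_conv[OF assms]] by (simp add: conv_def)

section \<open>Maps on the tensor square of \<open>H\<close> over \<open>L\<^sup>o\<^sup>p\<close>,
  where cocycles live, and two actions of \<open>Hom\<close> on them\<close>

definition Hom2 :: "('h \<Rightarrow> 'h \<Rightarrow> 'b) set" where
  "Hom2 = {u. (\<forall>k. (\<lambda>h. u h k) \<in> Hom) \<and> (\<forall>h k k'. u h (k + k') = u h k + u h k') \<and>
     (\<forall>h k l. u (h * tgt BG l) k = u h (tgt BG l * k))}"

lemma Hom2I:
  assumes "\<And>k. (\<lambda>h. u h k) \<in> Hom" "\<And>h k k'. u h (k + k') = u h k + u h k'"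
    and "\<And>h k l. u (h * tgt BG l) k = u h (tgt BG l * k)"
  shows "u \<in> Hom2"
  using assms by (simp add: Hom2_def)

lemma Hom2_Hom: "u \<in> Hom2 \<Longrightarrow> (\<lambda>h. u h k) \<in> Hom"
  and Hom2_add: "u \<in> Hom2 \<Longrightarrow> u h (k + k') = u h k + u h k'"
  and Hom2_tgt: "u \<in> Hom2 \<Longrightarrow> u (h * tgt BG l) k = u h (tgt BG l * k)"
  by (auto simp: Hom2_def)

text \<open>The left action of \<open>Hom\<close>, by convolution in the first argument.
  Balancedness survives because a factor \<open>t(l)\<close> on the right of \<open>h\<close> passes
  to the last component of the coproduct.\<close>

lemma Hom2_conv_left:
  assumes x: "x \<in> Hom" and u: "u \<in> Hom2"
  shows "(\<lambda>h k. (x \<diamondop> (\<lambda>h. u h k)) h) \<in> Hom2"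
  by (rule Hom2I)
    (simp_all add: conv_in_Hom x Hom2_Hom[OF u] Hom2_add[OF u] conv_add_right
      conv_mult_tgt Hom2_tgt[OF u])

text \<open>In Sweedler notation, \<open>dconv u x h k = u(h\<^sub>1, k\<^sub>1) x(h\<^sub>2 k\<^sub>2)\<close>.\<close>

definition dconv :: "('h \<Rightarrow> 'h \<Rightarrow> 'b) \<Rightarrow> ('h \<Rightarrow> 'b) \<Rightarrow> 'h \<Rightarrow> 'h \<Rightarrow> 'b" where
  "dconv u x h k = sw BG k (\<lambda>a b. ((\<lambda>h. u h a) \<diamondop> (\<lambda>h. x (h * b))) h)"

text \<open>A factor \<open>t(l)\<close> in front of \<open>a\<close> passes to the right of
  \<open>h1\<close> because \<open>u\<close> is balanced. By the Takeuchi axiom it then becomes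
  \<open>s(l)\<close> on the right of \<open>h2\<close>, that is, in front of
  \<open>b\<close>.\<close>

lemma balanced_dconv:
  assumes u: "u \<in> Hom2" and x: "x \<in> Hom"
  shows "balancedH BG (\<lambda>x. x) (\<lambda>a b. ((\<lambda>h. u h a) \<diamondop> (\<lambda>h. x (h * b))) h)"
proof (rule balancedI)
  fix a l b
  show "((\<lambda>h. u h (ractH BG a l)) \<diamondop> (\<lambda>h. x (h * b))) h =
      ((\<lambda>h. u h a) \<diamondop> (\<lambda>h. x (h * lactH BG l b))) h"
    using conv_takeuchi[OF Hom2_Hom[OF u, of a] Hom_mult_right[OF x, of b]]
    by (simp add: ractH_def lactH_def Hom2_tgt[OF u] mult.assoc)
qed (simp_all add: conv_add_left conv_add_right Hom2_add[OF u] Hom_add[OF x] distrib_left)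

lemma dconv_in_Hom2:
  assumes u: "u \<in> Hom2" and x: "x \<in> Hom"
  shows "dconv u x \<in> Hom2"
proof (rule Hom2I)
  show "(\<lambda>h. dconv u x h k) \<in> Hom" for k
    unfolding dconv_def by (intro Hom_sw conv_in_Hom Hom2_Hom[OF u] Hom_mult_right[OF x])
  show "dconv u x h (k + k') = dconv u x h k + dconv u x h k'" for h k k'
    by (simp add: dconv_def swB_add[OF balanced_dconv[OF u x]])
  show "dconv u x (h * tgt BG l) k = dconv u x h (tgt BG l * k)" for h k l
    by (simp add: dconv_def swB_tgt[OF balanced_dconv[OF u x]] mult.assoc
        conv_mult_tgt[OF Hom2_Hom[OF u] Hom_mult_right[OF x]])
qed

text \<open>Together with \<open>dconv_unit\<close> this makes \<open>dconv\<close> a right action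
  of the convolution algebra on \<open>Hom2\<close>, so that invertible elements act bijectively.
  The sum over \<open>h\<close> is regrouped by \<open>conv_assoc\<close>, the one over
  \<open>k\<close> by coassociativity.\<close>

lemma dconv_assoc:
  assumes u: "u \<in> Hom2" and x: "x \<in> Hom" and y: "y \<in> Hom"
  shows "dconv (dconv u x) y = dconv u (x \<diamondop> y)"
proof (intro ext)
  fix h k
  note Hom = Hom2_Hom[OF u] Hom_mult_right[OF x] Hom_mult_right[OF y] conv_in_Hom
  let ?f = "\<lambda>a b c. ((\<lambda>h. u h a) \<diamondop> (\<lambda>h. x (h * b)) \<diamondop> (\<lambda>h. y (h * c))) h"
  have bal_xy: "balancedH BG (\<lambda>x. x) (\<lambda>a b. x a * y b)"
    by (rule balanced_conv[OF x y])
  have "balanced3H BG (\<lambda>x. x) ?f"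
  proof (rule balanced3I)
    fix a l b c
    show "?f (ractH BG a l) b c = ?f a (lactH BG l b) c"
      using balanced_dconv[OF u x]
      by (simp add: conv_assoc[symmetric] Hom)
        (simp add: conv_def[of _ _ "\<lambda>h. y (h * c)"] balanced_def)
    have "(\<lambda>h. x (h * (tgt BG l * a))) \<diamondop> (\<lambda>h. y (h * c)) =
        (\<lambda>h. x (h * a)) \<diamondop> (\<lambda>h. y (h * (src BG l * c)))"
      using conv_takeuchi[OF Hom_mult_right[OF x, of a] Hom_mult_right[OF y, of c]]
      by (intro ext) (simp add: mult.assoc)
    then show "?f b (ractH BG a l) c = ?f b a (lactH BG l c)"
      by (simp add: ractH_def lactH_def)
  next
    fix a b c d
    have "(\<lambda>h. x (h * (b + c))) \<diamondop> (\<lambda>h. y (h * d)) =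
        (\<lambda>h. ((\<lambda>h. x (h * b)) \<diamondop> (\<lambda>h. y (h * d))) h + ((\<lambda>h. x (h * c)) \<diamondop> (\<lambda>h. y (h * d))) h)"
      by (intro ext) (simp add: distrib_left Hom_add[OF x] conv_add_left)
    then show "?f a (b + c) d = ?f a b d + ?f a c d"
      by (simp add: conv_add_right)
    have "(\<lambda>h. x (h * d)) \<diamondop> (\<lambda>h. y (h * (b + c))) =
        (\<lambda>h. ((\<lambda>h. x (h * d)) \<diamondop> (\<lambda>h. y (h * b))) h + ((\<lambda>h. x (h * d)) \<diamondop> (\<lambda>h. y (h * c))) h)"
      by (intro ext) (simp add: distrib_left Hom_add[OF y] conv_add_right)
    then show "?f a d (b + c) = ?f a d b + ?f a d c"
      by (simp add: conv_add_right)
  qed (simp add: Hom2_add[OF u] conv_add_left)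
  note coassoc = swB_coassoc[OF this, of k]
  have "dconv (dconv u x) y h k = sw BG k (\<lambda>k' c. sw BG k' (\<lambda>a b. ?f a b c))"
    by (simp only: dconv_def conv_sw_left
        conv_assoc[OF Hom2_Hom[OF u] Hom_mult_right[OF x] Hom_mult_right[OF y]])
  also note coassoc
  also have "sw BG k (\<lambda>a k'. sw BG k' (\<lambda>b c. ?f a b c)) = dconv u (x \<diamondop> y) h k"
  proof -
    \<comment> \<open>Multiplicativity of the coproduct, with the sum over \<open>k'\<close>
      outermost as in \<open>dconv\<close>.\<close>
    have "(x \<diamondop> y) (h * k') =
        sw BG k' (\<lambda>b c. ((\<lambda>h. x (h * b)) \<diamondop> (\<lambda>h. y (h * c))) h)" for h k'
      by (simp add: conv_def swB_mult[OF bal_xy])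
    then show ?thesis
      by (simp only: dconv_def conv_sw_right)
  qed
  finally show "dconv (dconv u x) y h k = dconv u (x \<diamondop> y) h k" .
qed

text \<open>Writing \<open>\<pi>(h k)\<close> as \<open>\<pi>(h s(\<pi>(k)))\<close>, the Takeuchi
  axiom moves \<open>\<pi>(k2)\<close> into the first factor, where it reaches \<open>k1\<close> as
  \<open>t(\<pi>(k2)) k1\<close>. The counit law then applies to \<open>h\<close> and to
  \<open>k\<close> in turn.\<close>

lemma dconv_unit:
  assumes u: "u \<in> Hom2"
  shows "dconv u (\<iota> \<circ> counit BG) = u"
proof (intro ext)
  fix h k
  have add: "u h 0 = 0"
    using Hom2_add[OF u, of h 0 0] by simp
  have "dconv u (\<iota> \<circ> counit BG) h k =
      sw BG k (\<lambda>a b. ((\<lambda>h. u h a) \<diamondop> (\<lambda>h. (\<iota> \<circ> counit BG) (h * src BG (counit BG b)))) h)"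
    by (simp add: dconv_def counit_mult_src)
  also have "\<dots> = sw BG k (\<lambda>a b. u h (tgt BG (counit BG b) * a))"
    by (simp only: conv_takeuchi[OF Hom2_Hom[OF u] Hom_counit, symmetric] Hom2_tgt[OF u]
        conv_unit_right[OF Hom2_Hom[OF u]])
  also have "\<dots> = u h k"
    using sw_hom[of "u h" BG k "\<lambda>a b. tgt BG (counit BG b) * a"]
    by (simp add: add Hom2_add[OF u] counit_right)
  finally show "dconv u (\<iota> \<circ> counit BG) h k = u h k" .
qed

text \<open>The left and the right action commute, by associativity of convolution in
  \<open>h\<close>.\<close>

lemma dconv_conv_left:
  assumes x: "x \<in> Hom" and u: "u \<in> Hom2" and y: "y \<in> Hom"
  shows "dconv (\<lambda>h k. (x \<diamondop> (\<lambda>h. u h k)) h) y = (\<lambda>h k. (x \<diamondop> (\<lambda>h. dconv u y h k)) h)"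
  by (intro ext) (simp add: dconv_def conv_sw_right conv_assoc x Hom2_Hom[OF u] Hom_mult_right[OF y])

lemma dconv_at_one:
  assumes u: "u \<in> Hom2" and x: "x \<in> Hom"
  shows "dconv u x h 1 = ((\<lambda>h. u h 1) \<diamondop> x) h"
  by (simp add: dconv_def swB_one[OF balanced_dconv[OF u x]])

section \<open>Gauge transforms and intertwining maps\<close>

lemma gauge_meas_eq:
  "gauge_meas BG x y m h b = (x \<diamondop> (\<lambda>h. m h b) \<diamondop> y) h"
  by (simp add: gauge_meas_def sw3_def conv_def sw_mult_left mult.assoc)

text \<open>In Sweedler notation, \<open>(h1 \<cdot> x(k1)) \<sigma>(h2, k2)\<close>, the middle
  part of the gauge transformed cocycle. The sum over \<open>k\<close> is outermost so that every
  summand is a convolution in \<open>h\<close>.\<close>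

definition coc_twist ::
    "('h, 'b) crossed_product_data \<Rightarrow> ('h \<Rightarrow> 'b) \<Rightarrow> 'h \<Rightarrow> 'h \<Rightarrow> 'b" where
  "coc_twist C x h k = sw BG k (\<lambda>a b. ((\<lambda>h. meas C h (x a)) \<diamondop> (\<lambda>h. coc C h b)) h)"

section \<open>The axioms of a crossed product in the convolution algebra\<close>

context
  fixes C :: "('h, 'b) crossed_product_data"
  assumes C: "crossed_product scH scB BG \<iota> C"
begin

lemma meas_Hom: "(\<lambda>h. meas C h b) \<in> Hom"
  using C by (intro HomI) (auto simp: crossed_product_def measuring_def k_linear_def)

lemma meas_add: "meas C h (b + b') = meas C h b + meas C h b'"
  using C by (auto simp: crossed_product_def measuring_def k_linear_def)

lemma meas_mult: "(\<lambda>h. meas C h (b * b')) = (\<lambda>h. meas C h b) \<diamondop> (\<lambda>h. meas C h b')"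
  using C by (auto simp: crossed_product_def measuring_def conv_def)

lemma meas_1: "(\<lambda>h. meas C h 1) = \<iota> \<circ> counit BG"
  using C by (auto simp: crossed_product_def measuring_def)

lemma coc_Hom2: "coc C \<in> Hom2"
  using C by (intro Hom2I HomI) (auto simp: crossed_product_def two_cocycle_def k_linear_def)

lemma coc_src: "(\<lambda>h. meas C h (\<iota> l)) \<diamondop> (\<lambda>h. coc C h k) = (\<lambda>h. coc C h (src BG l * k))"
  using C by (auto simp: crossed_product_def two_cocycle_def conv_def)

lemma coc_1_right: "(\<lambda>h. coc C h 1) = \<iota> \<circ> counit BG"
  using C by (auto simp: crossed_product_def two_cocycle_def)

lemma meas_coc_Hom2: "(\<lambda>h k. ((\<lambda>h. meas C h b) \<diamondop> (\<lambda>h. coc C h k)) h) \<in> Hom2"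
  by (rule Hom2_conv_left[OF meas_Hom coc_Hom2])

text \<open>The measuring splits \<open>b * \<iota> l\<close> into a convolution, and cocycle
  condition (b) absorbs the factor belonging to \<open>\<iota> l\<close>. So
  \<open>(h1 \<cdot> b) \<sigma>(h2, k)\<close> depends only on \<open>b \<otimes> k\<close> over
  \<open>L\<close>, as the crossed product requires.\<close>

lemma meas_coc_balanced:
  "(\<lambda>h. meas C h (b * \<iota> l)) \<diamondop> (\<lambda>h. coc C h k) =
   (\<lambda>h. meas C h b) \<diamondop> (\<lambda>h. coc C h (src BG l * k))"
  by (simp only: meas_mult conv_assoc[OF meas_Hom meas_Hom Hom2_Hom[OF coc_Hom2]] coc_src)

lemma balanced_coc_twist:
  assumes x: "x \<in> Hom"
  shows "balancedH BG (\<lambda>x. x) (\<lambda>a b. ((\<lambda>h. meas C h (x a)) \<diamondop> (\<lambda>h. coc C h b)) h)"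
  by (rule balancedI) (simp_all add: Hom_add[OF x] meas_add conv_add_left conv_add_right
      Hom2_add[OF coc_Hom2] ractH_def lactH_def Hom_tgt[OF x] meas_coc_balanced)

lemma coc_twist_Hom2:
  assumes x: "x \<in> Hom"
  shows "coc_twist C x \<in> Hom2"
proof (rule Hom2I)
  show "(\<lambda>h. coc_twist C x h k) \<in> Hom" for k
    unfolding coc_twist_def by (intro Hom_sw conv_in_Hom meas_Hom Hom2_Hom[OF coc_Hom2])
  show "coc_twist C x h (k + k') = coc_twist C x h k + coc_twist C x h k'" for h k k'
    by (simp add: coc_twist_def swB_add[OF balanced_coc_twist[OF x]])
  show "coc_twist C x (h * tgt BG l) k = coc_twist C x h (tgt BG l * k)" for h k l
    by (simp add: coc_twist_def swB_tgt[OF balanced_coc_twist[OF x]]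
        conv_mult_tgt[OF meas_Hom Hom2_Hom[OF coc_Hom2]] Hom2_tgt[OF coc_Hom2])
qed

lemma coc_twist_at_one:
  assumes "x \<in> Hom" "x 1 = 1"
  shows "(\<lambda>h. coc_twist C x h 1) = \<iota> \<circ> counit BG"
  by (simp only: coc_twist_def swB_one[OF balanced_coc_twist] assms meas_1 coc_1_right
      conv_unit_left[OF Hom_counit])

text \<open>The definition splits \<open>k\<close> as \<open>k1\<close> and then \<open>k2\<close>,
  \<open>k3\<close>, whereas the right-hand side first pairs \<open>k1\<close> with
  \<open>k2\<close>. The two agree by coassociativity once the summand is known to be balanced in
  all three components.\<close>

lemma gauge_coc_eq:
  assumes x: "x \<in> Hom" and y: "y \<in> Hom"
  shows "gauge_coc BG x y (meas C) (coc C) =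
    dconv (\<lambda>h k. (x \<diamondop> (\<lambda>h. coc_twist C x h k)) h) y"
proof (intro ext)
  fix h k
  let ?m = "\<lambda>b h. meas C h b" and ?s = "\<lambda>k h. coc C h k" and ?y = "\<lambda>c h. y (h * c)"
  let ?f = "\<lambda>a b c. (x \<diamondop> ?m (x a) \<diamondop> ?s b \<diamondop> ?y c) h"
  have assoc: "(x \<diamondop> ?m (x a) \<diamondop> ?s b) \<diamondop> ?y c = x \<diamondop> ?m (x a) \<diamondop> ?s b \<diamondop> ?y c" for a b c
    by (simp only: conv_assoc[OF x conv_in_Hom[OF meas_Hom Hom2_Hom[OF coc_Hom2]] Hom_mult_right[OF y]]
        conv_assoc[OF meas_Hom Hom2_Hom[OF coc_Hom2] Hom_mult_right[OF y]])
  have add_left: "(\<lambda>h. u h + v h) \<diamondop> w = (\<lambda>h. (u \<diamondop> w) h + (v \<diamondop> w) h)" for u v w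
    by (intro ext) (rule conv_add_left)
  have add_right: "w \<diamondop> (\<lambda>h. u h + v h) = (\<lambda>h. (w \<diamondop> u) h + (w \<diamondop> v) h)" for u v w
    by (intro ext) (rule conv_add_right)
  have "balanced3H BG (\<lambda>x. x) ?f"
  proof (rule balanced3I)
    fix a l b c
    have "?m (x (ractH BG a l)) \<diamondop> ?s b \<diamondop> ?y c = ?m (x a) \<diamondop> ?s (lactH BG l b) \<diamondop> ?y c"
      by (simp only: conv_assoc[OF meas_Hom Hom2_Hom[OF coc_Hom2] Hom_mult_right[OF y], symmetric]
          ractH_def lactH_def Hom_tgt[OF x] meas_coc_balanced)
    then show "?f (ractH BG a l) b c = ?f a (lactH BG l b) c"
      by simp
  next
    fix a l b c
    have "?s (ractH BG b l) \<diamondop> ?y c = ?s b \<diamondop> ?y (lactH BG l c)"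
      using conv_takeuchi[OF Hom2_Hom[OF coc_Hom2, of b] Hom_mult_right[OF y, of c], of l]
      by (intro ext) (simp add: ractH_def lactH_def Hom2_tgt[OF coc_Hom2] mult.assoc)
    then show "?f a (ractH BG b l) c = ?f a b (lactH BG l c)"
      by simp
  qed (simp_all add: Hom_add[OF x] Hom_add[OF y] meas_add Hom2_add[OF coc_Hom2] distrib_left
      add_left add_right)
  note coassoc = swB_coassoc[OF this, of k]
  have "gauge_coc BG x y (meas C) (coc C) h k = sw BG k (\<lambda>a k'. sw BG k' (\<lambda>b c. ?f a b c))"
    by (simp add: gauge_coc_def sw3_def sw4_def conv_def sw_mult_left mult.assoc)
  also note coassoc[symmetric]
  also have "sw BG k (\<lambda>k' c. sw BG k' (\<lambda>a b. ?f a b c)) =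
      dconv (\<lambda>h k. (x \<diamondop> (\<lambda>h. coc_twist C x h k)) h) y h k"
    by (simp only: dconv_def coc_twist_def conv_sw_right conv_sw_left assoc)
  finally show "gauge_coc BG x y (meas C) (coc C) h k =
      dconv (\<lambda>h k. (x \<diamondop> (\<lambda>h. coc_twist C x h k)) h) y h k" .
qed

end

text \<open>
  The identity to which multiplicativity of the map induced by \<open>x\<close> reduces; setting \<open>k = 1\<close> and \<open>b = 1\<close>
  separates the measuring from the cocycle.
\<close>

definition intertwiner ::
    "('h, 'b) crossed_product_data \<Rightarrow> ('h, 'b) crossed_product_data \<Rightarrow> ('h \<Rightarrow> 'b) \<Rightarrow> bool" where
  "intertwiner D C x \<longleftrightarrow>
     (\<forall>b. dconv (\<lambda>h k. ((\<lambda>h. meas D h b) \<diamondop> (\<lambda>h. coc D h k)) h) x =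
        (\<lambda>h k. (x \<diamondop> (\<lambda>h. meas C h b) \<diamondop> (\<lambda>h. coc_twist C x h k)) h))"

lemma intertwiner_iff_gauge_transform:
  assumes C: "crossed_product scH scB BG \<iota> C" and D: "crossed_product scH scB BG \<iota> D"
    and inv: "conv_inverse scH scB BG \<iota> x y" and x1: "x 1 = 1"
  shows "intertwiner D C x \<longleftrightarrow> D = gauge_transform BG x y C"
proof -
  have x: "x \<in> Hom" and y: "y \<in> Hom" and xy: "x \<diamondop> y = \<iota> \<circ> counit BG" and yx: "y \<diamondop> x = \<iota> \<circ> counit BG"
    using inv by (auto simp: conv_inverse_def)
  let ?m = "\<lambda>b h. meas C h b" and ?m' = "\<lambda>b h. meas D h b"
  let ?N = "\<lambda>h k. (x \<diamondop> (\<lambda>h. coc_twist C x h k)) h"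
  note m = meas_Hom[OF C] and m' = meas_Hom[OF D]
  note W = coc_twist_Hom2[OF C x] and W_Hom = Hom2_Hom[OF coc_twist_Hom2[OF C x]]
  note c' = coc_Hom2[OF D]
  note N = Hom2_conv_left[OF x W]
  have meas_iff: "?m' b \<diamondop> x = x \<diamondop> ?m b \<longleftrightarrow> ?m' b = x \<diamondop> ?m b \<diamondop> y" for b
  proof
    assume "?m' b \<diamondop> x = x \<diamondop> ?m b"
    then have "(?m' b \<diamondop> x) \<diamondop> y = (x \<diamondop> ?m b) \<diamondop> y"
      by simp
    then show "?m' b = x \<diamondop> ?m b \<diamondop> y"
      by (simp only: conv_assoc x y m m' xy conv_unit_right)
  next
    assume "?m' b = x \<diamondop> ?m b \<diamondop> y"
    then have "?m' b \<diamondop> x = (x \<diamondop> ?m b \<diamondop> y) \<diamondop> x"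
      by simp
    then show "?m' b \<diamondop> x = x \<diamondop> ?m b"
      by (simp only: conv_assoc x y m m' yx conv_unit_right conv_in_Hom)
  qed
  \<comment> \<open>Mutually inverse \<open>x\<close> and \<open>y\<close> act on
    \<open>Hom2\<close> from the right by mutually inverse maps.\<close>
  have coc_iff: "dconv (coc D) x = ?N \<longleftrightarrow> coc D = dconv ?N y"
  proof
    assume "dconv (coc D) x = ?N"
    then have "dconv (dconv (coc D) x) y = dconv ?N y"
      by simp
    then show "coc D = dconv ?N y"
      by (simp only: dconv_assoc[OF c' x y] xy dconv_unit[OF c'])
  next
    assume "coc D = dconv ?N y"
    then have "dconv (coc D) x = dconv (dconv ?N y) x"
      by simp
    then show "dconv (coc D) x = ?N"
      by (simp only: dconv_assoc[OF N y x] yx dconv_unit[OF N])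
  qed
  have "intertwiner D C x \<longleftrightarrow> (\<forall>b. ?m' b \<diamondop> x = x \<diamondop> ?m b) \<and> dconv (coc D) x = ?N"
  proof (intro iffI conjI allI)
    assume K: "intertwiner D C x"
    then have K: "dconv (\<lambda>h k. (?m' b \<diamondop> (\<lambda>h. coc D h k)) h) x h k =
        (x \<diamondop> ?m b \<diamondop> (\<lambda>h. coc_twist C x h k)) h" for b h k
      unfolding intertwiner_def by metis
    show "?m' b \<diamondop> x = x \<diamondop> ?m b" for b
    proof
      fix h
      show "(?m' b \<diamondop> x) h = (x \<diamondop> ?m b) h"
        \<comment> \<open>At \<open>k = 1\<close> the cocycle of \<open>D\<close> and the twisted
          cocycle of \<open>C\<close> both become the convolution unit; for the latter,
          \<open>x 1 = 1\<close> enters.\<close>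
        using K[of b h 1]
        by (simp only: dconv_at_one[OF meas_coc_Hom2[OF D] x] coc_1_right[OF D]
            conv_unit_right[OF m'] conv_unit_right[OF m] coc_twist_at_one[OF C x x1])
    qed
    show "dconv (coc D) x = ?N"
    proof (intro ext)
      fix h k
      show "dconv (coc D) x h k = ?N h k"
        using K[of 1 h k]
        by (simp only: meas_1[OF C] meas_1[OF D] conv_unit_left[OF Hom2_Hom[OF c']]
            conv_unit_left[OF W_Hom])
    qed
  next
    assume *: "(\<forall>b. ?m' b \<diamondop> x = x \<diamondop> ?m b) \<and> dconv (coc D) x = ?N"
    show "intertwiner D C x"
      unfolding intertwiner_def
    proof (intro allI ext)
      fix b h k
      \<comment> \<open>Since the two actions commute, the cocycle identity can be applied behind
        \<open>?m' b\<close>. The measuring identity then moves \<open>x\<close> to the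
        front.\<close>
      have "dconv (\<lambda>h k. (?m' b \<diamondop> (\<lambda>h. coc D h k)) h) x h k =
          (?m' b \<diamondop> (x \<diamondop> (\<lambda>h. coc_twist C x h k))) h"
        using * by (simp add: dconv_conv_left[OF m' c' x])
      also have "?m' b \<diamondop> (x \<diamondop> (\<lambda>h. coc_twist C x h k)) = x \<diamondop> ?m b \<diamondop> (\<lambda>h. coc_twist C x h k)"
        using * by (simp only: conv_assoc[OF m' x W_Hom, symmetric] conv_assoc[OF x m W_Hom])
      finally show "dconv (\<lambda>h k. (?m' b \<diamondop> (\<lambda>h. coc D h k)) h) x h k =
          (x \<diamondop> ?m b \<diamondop> (\<lambda>h. coc_twist C x h k)) h" .
    qed
  qed
  also have "\<dots> \<longleftrightarrow> (\<forall>b. ?m' b = x \<diamondop> ?m b \<diamondop> y) \<and> coc D = dconv ?N y"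
    by (simp only: meas_iff coc_iff)
  also have "\<dots> \<longleftrightarrow> D = gauge_transform BG x y C"
  proof -
    have "(\<forall>b. ?m' b = x \<diamondop> ?m b \<diamondop> y) \<longleftrightarrow> meas D = gauge_meas BG x y (meas C)"
      by (auto simp: fun_eq_iff gauge_meas_eq)
    then show ?thesis
      by (cases D) (simp add: gauge_transform_def gauge_coc_eq[OF C x y])
  qed
  finally show ?thesis .
qed

section \<open>The module underlying the crossed products\<close>

lemma sum_mset_sum_mset: "(\<Sum>g\<in>#(\<Sum>i\<in>#I. S i). \<phi> g) = (\<Sum>i\<in>#I. \<Sum>g\<in>#S i. \<phi> g)"
  by (induction I) simp_all

abbreviation cls :: "('b \<times> 'h) multiset \<Rightarrow> ('b \<times> 'h) multiset set" where
  "cls \<equiv> clsBH BG \<iota>"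

abbreviation balancedB ::
    "('m \<Rightarrow> 'q) \<Rightarrow> ('b \<Rightarrow> 'h \<Rightarrow> 'm::comm_monoid_add) \<Rightarrow> bool" where
  "balancedB q \<equiv> balanced q (\<lambda>b l. b * \<iota> l) (lactH BG)"

lemma additive_quotient_cls: "additive_quotient cls"
  unfolding clsBH_def by (rule additive_quotient_tensor)

interpretation cls: additive_quotient cls
  by (fact additive_quotient_cls)

lemma balanced_cls: "balancedB cls (\<lambda>b h. {#(b, h)#})"
  unfolding clsBH_def by (rule balanced_tensor)

lemma cls_add_left: "cls {#(b + b', h)#} = cls ({#(b, h)#} + {#(b', h)#})"
  and cls_add_right: "cls {#(b, h + h')#} = cls ({#(b, h)#} + {#(b, h')#})"
  and cls_move: "cls {#(b * \<iota> l, h)#} = cls {#(b, src BG l * h)#}"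
  using balanced_cls by (simp_all only: balanced_def lactH_def)

lemma cls_zero_left: "cls {#(0, h)#} = cls {#}"
  by (rule cls.zero_if_double) (use cls_add_left[of 0 0 h] in \<open>simp only: add_0\<close>)

lemma cls_rep [simp]: "cls (rep (cls x)) = cls x"
  by (simp add: clsBH_def)

lemma tsum_cls:
  assumes "additive_quotient q" "balancedB q f"
  shows "q (tsum f (cls x)) = q (\<Sum>(b, h)\<in>#x. f b h)"
  unfolding tsum_def
  by (rule additive_quotient.sum_tensor[OF assms]) (simp add: clsBH_def)

lemmas tsum_cls_mod = tsum_cls[OF additive_quotient_cls]

text \<open>Collects a Sweedler sum of coefficients in front of a fixed element of \<open>H\<close>,
  after coassociativity has isolated them.\<close>

lemma cls_sw_left: "cls (sw BG k (\<lambda>a b. {#(f a b, h)#})) = cls {#(sw BG k f, h)#}"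
  by (rule cls.sw_hom_mod[where \<phi> = "\<lambda>b. {#(b, h)#}", symmetric])
    (simp only: cls_zero_left, simp only: cls_add_left)

text \<open>Represents \<open>b x(h1) \<otimes> h2 k\<close>. With \<open>k = 1\<close> this is the
  image of \<open>b \<otimes> h\<close> under the map attached to \<open>x\<close>; general
  \<open>k\<close> accommodates the products \<open>h2 k2\<close> in the crossed product.\<close>

definition spread :: "'b \<Rightarrow> ('h \<Rightarrow> 'b) \<Rightarrow> 'h \<Rightarrow> 'h \<Rightarrow> ('b \<times> 'h) multiset" where
  "spread b x h k = sw BG h (\<lambda>d e. {#(b * x d, e * k)#})"

lemma balanced_spread:
  assumes x: "x \<in> Hom"
  shows "balancedH BG cls (\<lambda>d e. {#(b * x d, e * k)#})"
proof (rule balancedI)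
  show "cls {#(b * x (ractH BG d l), e * k)#} = cls {#(b * x d, lactH BG l e * k)#}" for d l e
    using cls_move[of "b * x d" l "e * k"]
    by (simp only: ractH_def lactH_def Hom_tgt[OF x] mult.assoc)
qed (simp_all only: Hom_add[OF x] distrib_left distrib_right cls_add_left cls_add_right)

lemma spread_add_left: "cls (spread (b + b') x h k) = cls (spread b x h k + spread b' x h k)"
  unfolding spread_def sw_plus[symmetric]
  by (rule cls.sw_cong) (simp only: distrib_right cls_add_left)

lemma spread_add_map:
  "cls (spread b (\<lambda>h. x h + y h) h k) = cls (spread b x h k + spread b y h k)"
  unfolding spread_def sw_plus[symmetric]
  by (rule cls.sw_cong) (simp only: distrib_left cls_add_left)

lemma spread_add_right: "cls (spread b x h (k + k')) = cls (spread b x h k + spread b x h k')"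
  unfolding spread_def sw_plus[symmetric]
  by (rule cls.sw_cong) (simp only: distrib_left cls_add_right)

lemma spread_add_arg:
  "x \<in> Hom \<Longrightarrow> cls (spread b x (h + h') k) = cls (spread b x h k + spread b x h' k)"
  unfolding spread_def by (rule sw_add[OF additive_quotient_cls balanced_spread])

lemma spread_src:
  assumes x: "x \<in> Hom"
  shows "cls (spread b x (src BG l * h) k) = cls (spread (b * \<iota> l) x h k)"
  unfolding spread_def sw_src[OF additive_quotient_cls balanced_spread[OF x]]
  by (simp only: Hom_src[OF x] mult.assoc)

lemma spread_takeuchi:
  assumes x: "x \<in> Hom"
  shows "cls (spread b (\<lambda>h. x (h * tgt BG l)) h k) = cls (spread b x h (src BG l * k))"
  using sw_takeuchi[OF additive_quotient_cls balanced_spread[OF x, of b k], of h l]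
  by (simp only: spread_def mult.assoc)

lemma spread_sw:
  "cls (spread b (\<lambda>h. sw BG k (\<lambda>a c. f a c h)) h j) = cls (sw BG k (\<lambda>a c. spread b (f a c) h j))"
proof -
  have "cls (sw BG k (\<lambda>a c. spread b (f a c) h j)) =
      cls (sw BG h (\<lambda>d e. sw BG k (\<lambda>a c. {#(b * f a c d, e * j)#})))"
    unfolding spread_def by (rule arg_cong[of _ _ cls], rule sw_swap)
  also have "\<dots> = cls (sw BG h (\<lambda>d e. {#(sw BG k (\<lambda>a c. b * f a c d), e * j)#}))"
    by (rule cls.sw_cong) (rule cls_sw_left)
  finally show ?thesis
    by (simp only: spread_def sw_mult_left)
qed

text \<open>Coassociativity in \<open>h\<close>. It accounts both for the composition of induced
  maps and for the form of the product in \<open>cp_mult_cls\<close>.\<close>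

lemma spread_conv:
  assumes x: "x \<in> Hom" and y: "y \<in> Hom"
  shows "cls (sw BG h (\<lambda>d e. spread (b * x d) y e k)) = cls (spread b (x \<diamondop> y) h k)"
proof -
  have "balanced3H BG cls (\<lambda>d p e. {#(b * x d * y p, e * k)#})"
  proof (rule balanced3I)
    show "cls {#(b * x d * y (ractH BG p l), e * k)#} =
        cls {#(b * x d * y p, lactH BG l e * k)#}" for d p l e
      using cls_move[of "b * x d * y p" l "e * k"]
      by (simp only: ractH_def lactH_def Hom_tgt[OF y] mult.assoc)
  qed (simp_all only: Hom_add[OF x] Hom_add[OF y] distrib_left distrib_right
      cls_add_left cls_add_right ractH_def lactH_def Hom_tgt[OF x] Hom_src[OF y] mult.assoc)
  from sw_coassoc[OF additive_quotient_cls this, of h]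
  have "cls (sw BG h (\<lambda>d e. spread (b * x d) y e k)) =
      cls (sw BG h (\<lambda>d' e. sw BG d' (\<lambda>d p. {#(b * x d * y p, e * k)#})))"
    by (simp only: spread_def)
  also have "\<dots> = cls (sw BG h (\<lambda>d' e. {#(sw BG d' (\<lambda>d p. b * x d * y p), e * k)#}))"
    by (rule cls.sw_cong) (rule cls_sw_left)
  finally show ?thesis
    by (simp only: spread_def conv_def sw_mult_left mult.assoc)
qed

text \<open>In Sweedler notation, \<open>spread2 b u h k\<close> represents \<open>b u(h\<^sub>1, k\<^sub>1) \<otimes> h\<^sub>2 k\<^sub>2\<close>.\<close>

definition spread2 :: "'b \<Rightarrow> ('h \<Rightarrow> 'h \<Rightarrow> 'b) \<Rightarrow> 'h \<Rightarrow> 'h \<Rightarrow> ('b \<times> 'h) multiset" where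
  "spread2 b u h k = sw BG k (\<lambda>a c. spread b (\<lambda>h. u h a) h c)"

lemma balanced_spread2:
  assumes u: "u \<in> Hom2"
  shows "balancedH BG cls (\<lambda>a c. spread b (\<lambda>h. u h a) h c)"
proof (rule balancedI)
  show "cls (spread b (\<lambda>h. u h (ractH BG a l)) h c) =
      cls (spread b (\<lambda>h. u h a) h (lactH BG l c))" for a l c
    by (simp only: ractH_def lactH_def Hom2_tgt[OF u, symmetric] spread_takeuchi[OF Hom2_Hom[OF u]])
qed (simp_all only: Hom2_add[OF u] spread_add_map spread_add_right)

lemma balanced_spread2_left:
  assumes u: "u \<in> Hom2"
  shows "balancedB cls (\<lambda>b h. spread2 b u h k)"
proof (rule balancedI)
  show "cls (spread2 (b + b') u h k) = cls (spread2 b u h k + spread2 b' u h k)" for b b' h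
    unfolding spread2_def sw_plus[symmetric] by (rule cls.sw_cong) (rule spread_add_left)
  show "cls (spread2 b u (h + h') k) = cls (spread2 b u h k + spread2 b u h' k)" for b h h'
    unfolding spread2_def sw_plus[symmetric]
    by (rule cls.sw_cong) (rule spread_add_arg[OF Hom2_Hom[OF u]])
  show "cls (spread2 (b * \<iota> l) u h k) = cls (spread2 b u (lactH BG l h) k)" for b l h
    unfolding spread2_def lactH_def
    by (rule cls.sw_cong) (rule spread_src[OF Hom2_Hom[OF u], symmetric])
qed

text \<open>Coassociativity in \<open>k\<close>: the first two of its three components are gathered
  into one coefficient. Membership in \<open>Hom2\<close> provides balancedness between the last two
  components, and the other hypotheses that between the first two.\<close>

lemma spread2_coassoc:
  assumes Hom2: "\<And>a. (\<lambda>h c. f a c h) \<in> Hom2"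
    and add: "\<And>a a' c h. f (a + a') c h = f a c h + f a' c h"
    and bal: "\<And>a l c h. f (tgt BG l * a) c h = f a (src BG l * c) h"
  shows "cls (sw BG k (\<lambda>a k'. sw BG k' (\<lambda>c d. spread b (f a c) h d))) =
    cls (spread2 b (\<lambda>h k. sw BG k (\<lambda>a c. f a c h)) h k)"
proof -
  have "balanced3H BG cls (\<lambda>a c d. spread b (f a c) h d)"
  proof (rule balanced3I)
    fix a a' c d l
    show "cls (spread b (f (a + a') c) h d) = cls (spread b (f a c) h d + spread b (f a' c) h d)"
      using spread_add_map[of b "f a c" "f a' c" h d] by (simp only: add[abs_def])
    have "f (ractH BG a l) c = f a (lactH BG l c)"
      by (intro ext) (simp only: ractH_def lactH_def bal)
    then show "cls (spread b (f (ractH BG a l) c) h d) = cls (spread b (f a (lactH BG l c)) h d)"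
      by simp
  next
    fix a c c' d d' l
    show "cls (spread b (f a (c + c')) h d) = cls (spread b (f a c) h d + spread b (f a c') h d)"
      "cls (spread b (f a c) h (d + d')) = cls (spread b (f a c) h d + spread b (f a c) h d')"
      "cls (spread b (f a (ractH BG c l)) h d) = cls (spread b (f a c) h (lactH BG l d))"
      using balanced_spread2[OF Hom2[of a], of b h] by (simp_all only: balanced_def)
  qed
  then have "cls (sw BG k (\<lambda>a k'. sw BG k' (\<lambda>c d. spread b (f a c) h d))) =
      cls (sw BG k (\<lambda>k' d. sw BG k' (\<lambda>a c. spread b (f a c) h d)))"
    by (simp only: sw_coassoc[OF additive_quotient_cls])
  also have "\<dots> = cls (spread2 b (\<lambda>h k. sw BG k (\<lambda>a c. f a c h)) h k)"
    unfolding spread2_def by (rule cls.sw_cong) (rule spread_sw[symmetric])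
  finally show ?thesis .
qed

text \<open>The map \<open>B \<otimes> \<pi>\<close>, with \<open>B \<otimes> L\<close> over
  \<open>L\<close> identified with \<open>B\<close>.\<close>

definition apply_counit :: "('b \<times> 'h) multiset set \<Rightarrow> 'b" where
  "apply_counit X = tsum (\<lambda>b h. b * \<iota> (counit BG h)) X"

lemma apply_counit_cls: "apply_counit (cls z) = (\<Sum>(b, h)\<in>#z. b * \<iota> (counit BG h))"
proof -
  have "balancedB (\<lambda>x. x) (\<lambda>b h. b * \<iota> (counit BG h))"
    by (rule balancedI) (simp_all add: counit_add iota_add distrib_left distrib_right
        lactH_def counit_src iota_mult mult.assoc)
  from tsum_cls[OF additive_quotient_id this] show ?thesis
    by (simp only: apply_counit_def)
qed

text \<open>Applying \<open>\<pi>\<close> to \<open>h2 k2\<close> amounts to \<open>dconv\<close>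
  with the convolution unit. Hence \<open>u\<close> can be read off from its spread, and equations
  in the crossed product become equations in \<open>Hom2\<close>.\<close>

lemma apply_counit_spread2:
  assumes u: "u \<in> Hom2"
  shows "apply_counit (cls (spread2 b u h k)) = b * u h k"
proof -
  have "apply_counit (cls (spread2 b u h k)) = b * dconv u (\<iota> \<circ> counit BG) h k"
    by (simp add: apply_counit_cls spread2_def spread_def sw_sum_mset dconv_def conv_def
        sw_mult_left mult.assoc)
  then show ?thesis
    by (simp only: dconv_unit[OF u])
qed

section \<open>Induced endomorphisms and their multiplicativity\<close>

definition induced :: "('h \<Rightarrow> 'b) \<Rightarrow> ('b \<times> 'h) multiset set \<Rightarrow> ('b \<times> 'h) multiset set" where
  "induced x X = cls (tsum (\<lambda>b h. spread b x h 1) X)"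

lemma induced_cls:
  assumes x: "x \<in> Hom"
  shows "induced x (cls z) = cls (\<Sum>(b, h)\<in>#z. spread b x h 1)"
  unfolding induced_def
proof (rule tsum_cls_mod, rule balancedI)
  show "cls (spread (b * \<iota> l) x h 1) = cls (spread b x (lactH BG l h) 1)" for b l h
    unfolding lactH_def by (rule spread_src[OF x, symmetric])
qed (simp_all only: spread_add_left spread_add_arg[OF x])

text \<open>The image is \<open>b u(h1, k1) x(h2 k2) \<otimes> h3 k3\<close>. The coproduct of
  \<open>h2 k2\<close> is multiplicative, then \<open>spread_conv\<close> regroups \<open>h\<close>
  and \<open>spread2_coassoc\<close> regroups \<open>k\<close>.\<close>

lemma induced_spread2:
  assumes x: "x \<in> Hom" and u: "u \<in> Hom2"
  shows "induced x (cls (spread2 b u h k)) = cls (spread2 b (dconv u x) h k)"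
proof -
  have mult: "cls (spread b x (e * c) 1) =
      cls (sw BG c (\<lambda>c1 c2. spread b (\<lambda>h. x (h * c1)) e c2))" for b e c
    using sw_mult[OF additive_quotient_cls balanced_spread[OF x, of b 1], of e c]
    by (simp add: spread_def)
  have "induced x (cls (spread2 b u h k)) =
      cls (sw BG k (\<lambda>a c. sw BG h (\<lambda>d e. spread (b * u d a) x (e * c) 1)))"
    by (simp add: induced_cls[OF x] spread2_def spread_def[of _ "\<lambda>h. u h _"] sw_sum_mset)
  also have "\<dots> = cls (sw BG k (\<lambda>a c. sw BG h (\<lambda>d e.
      sw BG c (\<lambda>c1 c2. spread (b * u d a) (\<lambda>h. x (h * c1)) e c2))))"
    by (intro cls.sw_cong) (rule mult)
  also have "\<dots> = cls (sw BG k (\<lambda>a c. sw BG c (\<lambda>c1 c2.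
      sw BG h (\<lambda>d e. spread (b * u d a) (\<lambda>h. x (h * c1)) e c2))))"
    by (simp only: sw_swap[of BG h])
  also have "\<dots> = cls (sw BG k (\<lambda>a c. sw BG c (\<lambda>c1 c2.
      spread b ((\<lambda>h. u h a) \<diamondop> (\<lambda>h. x (h * c1))) h c2)))"
    by (intro cls.sw_cong) (rule spread_conv[OF Hom2_Hom[OF u] Hom_mult_right[OF x]])
  also have "\<dots> = cls (spread2 b (dconv u x) h k)"
    unfolding dconv_def
  proof (rule spread2_coassoc)
    have "(\<lambda>h c. x (h * c)) \<in> Hom2"
      by (rule Hom2I) (simp_all add: Hom_mult_right x Hom_add distrib_left mult.assoc)
    then show "(\<lambda>h c. ((\<lambda>h. u h a) \<diamondop> (\<lambda>h. x (h * c))) h) \<in> Hom2" for a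
      by (rule Hom2_conv_left[OF Hom2_Hom[OF u]])
  qed (use balanced_dconv[OF u x] in \<open>simp_all only: balanced_def ractH_def lactH_def\<close>)
  finally show ?thesis .
qed

text \<open>Frees the product from the representatives chosen in its definition. The inner sum, over
  the left factor, is handled first; \<open>meas_coc_balanced\<close> then settles the outer
  one.\<close>

lemma cp_mult_cls:
  assumes C: "crossed_product scH scB BG \<iota> C"
  shows "cp_mult BG \<iota> C (cls z) (cls w) = cls (\<Sum>(b', h')\<in>#w. \<Sum>(b, h)\<in>#z.
    spread2 b (\<lambda>h k. ((\<lambda>h. meas C h b') \<diamondop> (\<lambda>h. coc C h k)) h) h h')"
proof -
  let ?u = "\<lambda>b' h k. ((\<lambda>h. meas C h b') \<diamondop> (\<lambda>h. coc C h k)) h"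
  let ?t = "\<lambda>b h b' h'. sw BG h' (\<lambda>h1' h2'. sw3 BG h (\<lambda>h1 h2 h3.
         {#(b * meas C h1 b' * coc C h2 h1', h3 * h2')#}))"
  \<comment> \<open>On pure tensors, \<open>spread_conv\<close> merges the first two components of
    \<open>h\<close> into one convolution of measuring and cocycle.\<close>
  have t: "cls (?t b h b' h') = cls (spread2 b (?u b') h h')" for b h b' h'
    unfolding spread2_def sw3_def
    by (rule cls.sw_cong)
      (use spread_conv[OF meas_Hom[OF C] Hom2_Hom[OF coc_Hom2[OF C]]] in \<open>simp only: spread_def\<close>)
  have inner: "cls (tsum (\<lambda>b h. ?t b h b' h') (cls z)) =
      cls (\<Sum>(b, h)\<in>#z. spread2 b (?u b') h h')" for b' h'
  proof -
    have "cls (tsum (\<lambda>b h. ?t b h b' h') (cls z)) =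
        cls (tsum (\<lambda>b h. spread2 b (?u b') h h') (cls z))"
      unfolding tsum_def by (rule cls.cong_sum) (auto simp: t)
    also have "\<dots> = cls (\<Sum>(b, h)\<in>#z. spread2 b (?u b') h h')"
      by (rule tsum_cls_mod[OF balanced_spread2_left[OF meas_coc_Hom2[OF C]]])
    finally show ?thesis .
  qed
  have "cp_mult BG \<iota> C (cls z) (cls w) =
      cls (tsum (\<lambda>b' h'. \<Sum>(b, h)\<in>#z. spread2 b (?u b') h h') (cls w))"
    unfolding cp_mult_def tsum_def[of _ "cls w"] by (rule cls.cong_sum) (auto simp: inner)
  also have "\<dots> = cls (\<Sum>(b', h')\<in>#w. \<Sum>(b, h)\<in>#z. spread2 b (?u b') h h')"
  proof (rule tsum_cls_mod, rule balancedI)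
    fix b' b'' :: 'b and h' h'' l
    have *: "cls (\<Sum>(b, h)\<in>#z. f b h) = cls ((\<Sum>(b, h)\<in>#z. g b h) + (\<Sum>(b, h)\<in>#z. g' b h))"
      if "\<And>b h. cls (f b h) = cls (g b h + g' b h)" for f g g'
      unfolding sum_mset.distrib[symmetric] by (rule cls.cong_sum) (auto simp: that)
    show "cls (\<Sum>(b, h)\<in>#z. spread2 b (?u (b' + b'')) h h') =
        cls ((\<Sum>(b, h)\<in>#z. spread2 b (?u b') h h') + (\<Sum>(b, h)\<in>#z. spread2 b (?u b'') h h'))"
      by (rule *, unfold spread2_def sw_plus[symmetric], rule cls.sw_cong)
        (simp only: meas_add[OF C] conv_add_left spread_add_map)
    show "cls (\<Sum>(b, h)\<in>#z. spread2 b (?u b') h (h' + h'')) =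
        cls ((\<Sum>(b, h)\<in>#z. spread2 b (?u b') h h') + (\<Sum>(b, h)\<in>#z. spread2 b (?u b') h h''))"
      by (rule *, unfold spread2_def)
        (rule sw_add[OF additive_quotient_cls balanced_spread2[OF meas_coc_Hom2[OF C]]])
    show "cls (\<Sum>(b, h)\<in>#z. spread2 b (?u (b' * \<iota> l)) h h') =
        cls (\<Sum>(b, h)\<in>#z. spread2 b (?u b') h (lactH BG l h'))"
    proof (rule cls.cong_sum, clarify)
      fix b h
      show "cls (spread2 b (?u (b' * \<iota> l)) h h') = cls (spread2 b (?u b') h (lactH BG l h'))"
        unfolding spread2_def lactH_def
          sw_src[OF additive_quotient_cls balanced_spread2[OF meas_coc_Hom2[OF C]]]
        by (simp only: meas_coc_balanced[OF C])
    qed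
  qed
  finally show ?thesis .
qed

text \<open>The product of the images of \<open>b \<otimes> h\<close> and
  \<open>b' \<otimes> h'\<close>. After regrouping \<open>h\<close> and \<open>h'\<close>,
  multiplicativity of the measuring separates \<open>b'\<close> from \<open>x(h'1)\<close>, and the
  latter combines with the cocycle into \<open>coc_twist\<close>.\<close>

lemma cp_mult_induced:
  assumes C: "crossed_product scH scB BG \<iota> C" and x: "x \<in> Hom"
  shows "cls (\<Sum>(b', h')\<in>#spread b' x h' 1. \<Sum>(b, h)\<in>#spread b x h 1.
      spread2 b (\<lambda>h k. ((\<lambda>h. meas C h b') \<diamondop> (\<lambda>h. coc C h k)) h) h h') =
    cls (spread2 b (\<lambda>h k. (x \<diamondop> (\<lambda>h. meas C h b') \<diamondop> (\<lambda>h. coc_twist C x h k)) h) h h')"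
proof -
  let ?m = "\<lambda>b h. meas C h b" and ?s = "\<lambda>k h. coc C h k"
  note m = meas_Hom[OF C] and s = Hom2_Hom[OF coc_Hom2[OF C]]
  have assoc: "?m (b' * x a) \<diamondop> ?s c = ?m b' \<diamondop> ?m (x a) \<diamondop> ?s c" for a c
    by (simp only: meas_mult[OF C] conv_assoc[OF m m s])
  have "cls (\<Sum>(b', h')\<in>#spread b' x h' 1. \<Sum>(b, h)\<in>#spread b x h 1.
      spread2 b (\<lambda>h k. (?m b' \<diamondop> ?s k) h) h h') =
      cls (sw BG h' (\<lambda>a c. sw BG h (\<lambda>d e.
        sw BG c (\<lambda>c1 c2. spread (b * x d) (?m (b' * x a) \<diamondop> ?s c1) e c2))))"
    by (simp add: spread_def[of _ x] sw_sum_mset spread2_def)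
  also have "\<dots> = cls (sw BG h' (\<lambda>a c. sw BG c (\<lambda>c1 c2.
      sw BG h (\<lambda>d e. spread (b * x d) (?m (b' * x a) \<diamondop> ?s c1) e c2))))"
    by (simp only: sw_swap[of BG h])
  also have "\<dots> = cls (sw BG h' (\<lambda>a c. sw BG c (\<lambda>c1 c2.
      spread b (x \<diamondop> ?m (b' * x a) \<diamondop> ?s c1) h c2)))"
    by (intro cls.sw_cong) (rule spread_conv[OF x conv_in_Hom[OF m s]])
  also have "\<dots> = cls (spread2 b (\<lambda>h k. sw BG k (\<lambda>a c. (x \<diamondop> ?m (b' * x a) \<diamondop> ?s c) h)) h h')"
  proof (rule spread2_coassoc)
    show "(\<lambda>h c. (x \<diamondop> ?m (b' * x a) \<diamondop> ?s c) h) \<in> Hom2" for a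
      by (rule Hom2_conv_left[OF x meas_coc_Hom2[OF C]])
    have add: "?m (p + q) \<diamondop> ?s c = (\<lambda>h. (?m p \<diamondop> ?s c) h + (?m q \<diamondop> ?s c) h)" for p q c
      by (intro ext) (simp only: meas_add[OF C] conv_add_left)
    show "(x \<diamondop> ?m (b' * x (a + a')) \<diamondop> ?s c) h =
        (x \<diamondop> ?m (b' * x a) \<diamondop> ?s c) h + (x \<diamondop> ?m (b' * x a') \<diamondop> ?s c) h" for a a' c h
      by (simp only: Hom_add[OF x] distrib_left add conv_add_right)
    show "(x \<diamondop> ?m (b' * x (tgt BG l * a)) \<diamondop> ?s c) h =
        (x \<diamondop> ?m (b' * x a) \<diamondop> ?s (src BG l * c)) h" for a l c h
      by (simp only: Hom_tgt[OF x] mult.assoc[symmetric] meas_coc_balanced[OF C])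
  qed
  also have "(\<lambda>h k. sw BG k (\<lambda>a c. (x \<diamondop> ?m (b' * x a) \<diamondop> ?s c) h)) =
      (\<lambda>h k. (x \<diamondop> ?m b' \<diamondop> (\<lambda>h. coc_twist C x h k)) h)"
  proof (intro ext)
    fix h k
    have "?m b' \<diamondop> (\<lambda>h. coc_twist C x h k) =
        (\<lambda>h. sw BG k (\<lambda>a c. (?m b' \<diamondop> ?m (x a) \<diamondop> ?s c) h))"
      by (intro ext) (simp only: coc_twist_def conv_sw_right)
    then show "sw BG k (\<lambda>a c. (x \<diamondop> ?m (b' * x a) \<diamondop> ?s c) h) =
        (x \<diamondop> ?m b' \<diamondop> (\<lambda>h. coc_twist C x h k)) h"
      by (simp only: assoc conv_sw_right)
  qed
  finally show ?thesis .
qed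

lemma cp_carrier_iff: "X \<in> cp_carrier BG \<iota> \<longleftrightarrow> (\<exists>z. X = cls z)"
  by (auto simp: cp_carrier_def)

text \<open>Both sides are sums of \<open>spread2\<close> terms over the same pairs of pure tensors,
  with coefficients given by the two sides of the intertwining identity.\<close>

lemma induced_mult_iff:
  assumes C: "crossed_product scH scB BG \<iota> C" and D: "crossed_product scH scB BG \<iota> D"
    and x: "x \<in> Hom"
  shows "(\<forall>X\<in>cp_carrier BG \<iota>. \<forall>Y\<in>cp_carrier BG \<iota>.
      induced x (cp_mult BG \<iota> D X Y) = cp_mult BG \<iota> C (induced x X) (induced x Y)) \<longleftrightarrow>
    intertwiner D C x"
proof -
  let ?u = "\<lambda>C b' h k. ((\<lambda>h. meas C h b') \<diamondop> (\<lambda>h. coc C h k)) h"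
  let ?v = "\<lambda>b' h k. (x \<diamondop> (\<lambda>h. meas C h b') \<diamondop> (\<lambda>h. coc_twist C x h k)) h"
  have lhs: "induced x (cp_mult BG \<iota> D (cls z) (cls w)) =
      cls (\<Sum>(b', h')\<in>#w. \<Sum>(b, h)\<in>#z. spread2 b (dconv (?u D b') x) h h')" for z w
  proof -
    have *: "cls (\<Sum>(b, h)\<in>#spread2 b (?u D b') h h'. spread b x h 1) =
        cls (spread2 b (dconv (?u D b') x) h h')" for b b' h h'
      using induced_spread2[OF x meas_coc_Hom2[OF D], of b b' h h']
      by (simp only: induced_cls[OF x])
    show ?thesis
      unfolding cp_mult_cls[OF D] induced_cls[OF x] case_prod_unfold sum_mset_sum_mset
      by (intro cls.cong_sum) (use * in \<open>simp only: case_prod_unfold\<close>)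
  qed
  have rhs: "cp_mult BG \<iota> C (induced x (cls z)) (induced x (cls w)) =
      cls (\<Sum>(b', h')\<in>#w. \<Sum>(b, h)\<in>#z. spread2 b (?v b') h h')" for z w
  proof -
    have "cp_mult BG \<iota> C (induced x (cls z)) (induced x (cls w)) =
        cls (\<Sum>g'\<in>#w. \<Sum>g\<in>#z. \<Sum>(b', h')\<in>#spread (fst g') x (snd g') 1.
          \<Sum>(b, h)\<in>#spread (fst g) x (snd g) 1. spread2 b (?u C b') h h')"
      unfolding cp_mult_cls[OF C] induced_cls[OF x] case_prod_unfold sum_mset_sum_mset
      by (intro arg_cong[of _ _ cls] arg_cong[of _ _ sum_mset] image_mset_cong sum_mset.swap)
    also have "\<dots> = cls (\<Sum>g'\<in>#w. \<Sum>g\<in>#z. spread2 (fst g) (?v (fst g')) (snd g) (snd g'))"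
      by (intro cls.cong_sum cp_mult_induced[OF C x])
    finally show ?thesis
      by (simp only: case_prod_unfold)
  qed
  have Hom2: "dconv (?u D b') x \<in> Hom2" "?v b' \<in> Hom2" for b'
    using dconv_in_Hom2[OF meas_coc_Hom2[OF D] x]
      Hom2_conv_left[OF x Hom2_conv_left[OF meas_Hom[OF C] coc_twist_Hom2[OF C x]]] by auto
  show ?thesis
  proof
    assume mult: "\<forall>X\<in>cp_carrier BG \<iota>. \<forall>Y\<in>cp_carrier BG \<iota>.
      induced x (cp_mult BG \<iota> D X Y) = cp_mult BG \<iota> C (induced x X) (induced x Y)"
    show "intertwiner D C x"
      unfolding intertwiner_def
    proof (intro allI ext)
      fix b' h h'
      \<comment> \<open>The pure tensors \<open>1 \<otimes> h\<close> and
        \<open>b' \<otimes> h'\<close> suffice, because \<open>B \<otimes> \<pi>\<close> recovers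
        the coefficients.\<close>
      have "cls (spread2 1 (dconv (?u D b') x) h h') = cls (spread2 1 (?v b') h h')"
        using mult[rule_format, of "cls {#(1, h)#}" "cls {#(b', h')#}"]
        unfolding lhs rhs by (simp add: cp_carrier_def)
      then have "1 * dconv (?u D b') x h h' = 1 * ?v b' h h'"
        by (metis apply_counit_spread2[OF Hom2(1)] apply_counit_spread2[OF Hom2(2)])
      then show "dconv (?u D b') x h h' = ?v b' h h'"
        by simp
    qed
  next
    assume "intertwiner D C x"
    then show "\<forall>X\<in>cp_carrier BG \<iota>. \<forall>Y\<in>cp_carrier BG \<iota>.
      induced x (cp_mult BG \<iota> D X Y) = cp_mult BG \<iota> C (induced x X) (induced x Y)"
      by (auto simp: cp_carrier_def lhs rhs intertwiner_def)
  qed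
qed

section \<open>Comodule maps\<close>

abbreviation cls3 :: "('b \<times> 'h \<times> 'h) multiset \<Rightarrow> ('b \<times> 'h \<times> 'h) multiset set" where
  "cls3 \<equiv> clsBHH BG \<iota>"

lemma additive_quotient_cls3: "additive_quotient cls3"
  unfolding clsBHH_def by (rule additive_quotient_tensor3)

interpretation cls3: additive_quotient cls3
  by (fact additive_quotient_cls3)

lemma cls3_add1: "cls3 {#(b + b', h, k)#} = cls3 ({#(b, h, k)#} + {#(b', h, k)#})"
  and cls3_add2: "cls3 {#(b, h + h', k)#} = cls3 ({#(b, h, k)#} + {#(b, h', k)#})"
  and cls3_add3: "cls3 {#(b, h, k + k')#} = cls3 ({#(b, h, k)#} + {#(b, h, k')#})"
  and cls3_move1: "cls3 {#(b * \<iota> l, h, k)#} = cls3 {#(b, src BG l * h, k)#}"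
  and cls3_move2: "cls3 {#(b, tgt BG l * h, k)#} = cls3 {#(b, h, src BG l * k)#}"
  using balanced3_tensor3[of "\<lambda>b l. b * \<iota> l" "lactH BG" "ractH BG" "lactH BG"]
  by (simp_all only: balanced3_def clsBHH_def lactH_def ractH_def)

lemma cls_in_carrier: "cls z \<in> cp_carrier BG \<iota>"
  by (simp add: cp_carrier_def)

lemma cp_add_cls: "cp_add BG \<iota> (cls z) (cls w) = cls (z + w)"
  unfolding cp_add_def by (rule cls.cong_add) simp_all

lemma cp_lact_cls: "cp_lact BG \<iota> b (cls z) = cls (\<Sum>(b', h)\<in>#z. {#(b * b', h)#})"
  unfolding cp_lact_def
  by (rule tsum_cls_mod, rule balancedI)
    (simp_all only: distrib_left cls_add_left cls_add_right mult.assoc[symmetric] cls_move lactH_def)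

lemma cp_ract_cls: "cp_ract BG \<iota> (cls z) l = cls (\<Sum>(b, h)\<in>#z. {#(b, tgt BG l * h)#})"
  unfolding cp_ract_def ractH_def
proof (rule tsum_cls_mod, rule balancedI)
  fix b l' h
  have "src BG l' * (tgt BG l * h) = tgt BG l * (src BG l' * h)"
    by (simp only: mult.assoc[symmetric] src_tgt_commute)
  then show "cls {#(b * \<iota> l', tgt BG l * h)#} = cls {#(b, tgt BG l * lactH BG l' h)#}"
    by (simp only: cls_move lactH_def)
qed (simp_all only: distrib_left cls_add_left cls_add_right)

lemma balanced_coact: "balancedH BG cls3 (\<lambda>h1 h2. {#(b, h1, h2)#})"
  by (rule balancedI) (simp_all only: cls3_add2 cls3_add3 cls3_move2 ractH_def lactH_def)

lemma cp_coact_cls: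
  "cp_coact BG \<iota> (cls z) = cls3 (\<Sum>(b, h)\<in>#z. sw BG h (\<lambda>h1 h2. {#(b, h1, h2)#}))"
  unfolding cp_coact_def
proof (rule tsum_cls[OF additive_quotient_cls3], rule balancedI)
  note src = sw_src[OF additive_quotient_cls3 balanced_coact]
    and add = sw_add[OF additive_quotient_cls3 balanced_coact]
  show "cls3 (sw BG h (\<lambda>h1 h2. {#(b + b', h1, h2)#})) =
      cls3 (sw BG h (\<lambda>h1 h2. {#(b, h1, h2)#}) + sw BG h (\<lambda>h1 h2. {#(b', h1, h2)#}))" for b b' h
    unfolding sw_plus[symmetric] by (rule cls3.sw_cong) (rule cls3_add1)
  show "cls3 (sw BG (h + h') (\<lambda>h1 h2. {#(b, h1, h2)#})) =
      cls3 (sw BG h (\<lambda>h1 h2. {#(b, h1, h2)#}) + sw BG h' (\<lambda>h1 h2. {#(b, h1, h2)#}))" for b h h'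
    by (rule add)
  show "cls3 (sw BG h (\<lambda>h1 h2. {#(b * \<iota> l, h1, h2)#})) =
      cls3 (sw BG (lactH BG l h) (\<lambda>h1 h2. {#(b, h1, h2)#}))" for b l h
    unfolding lactH_def src by (rule cls3.sw_cong) (rule cls3_move1)
qed

lemma cp_lact_pure: "cp_lact BG \<iota> b (cls {#(b', h)#}) = cls {#(b * b', h)#}"
  by (simp add: cp_lact_cls)

lemma cp_ract_pure: "cp_ract BG \<iota> (cls {#(b, h)#}) l = cls {#(b, tgt BG l * h)#}"
  by (simp add: cp_ract_cls)

section \<open>Linearity of the counit map and composition of induced maps\<close>

lemma apply_counit_add:
  "apply_counit (cp_add BG \<iota> (cls z) (cls w)) = apply_counit (cls z) + apply_counit (cls w)"
  by (simp add: cp_add_cls apply_counit_cls)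

lemma apply_counit_lact:
  "apply_counit (cp_lact BG \<iota> b (cls z)) = b * apply_counit (cls z)"
  unfolding cp_lact_cls apply_counit_cls
  by (induction z) (auto simp: distrib_left mult.assoc)

lemma apply_counit_ract:
  "apply_counit (cp_ract BG \<iota> (cls z) l) = apply_counit (cls z) * \<iota> l"
  unfolding cp_ract_cls apply_counit_cls
  by (induction z) (auto simp: distrib_right mult.assoc counit_tgt iota_mult)

lemma spread_counit: "cls (spread b (\<iota> \<circ> counit BG) h 1) = cls {#(b, h)#}"
proof -
  have zero: "cls {#(b, 0)#} = cls {#}"
    by (rule cls.zero_if_double) (use cls_add_right[of b 0 0] in \<open>simp only: add_0\<close>)
  have "cls (spread b (\<iota> \<circ> counit BG) h 1) =
      cls (sw BG h (\<lambda>d e. {#(b, src BG (counit BG d) * e)#}))"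
    unfolding spread_def by (rule cls.sw_cong) (simp add: cls_move)
  also have "\<dots> = cls {#(b, sw BG h (\<lambda>d e. src BG (counit BG d) * e))#}"
    by (rule cls.sw_hom_mod[where \<phi> = "\<lambda>h. {#(b, h)#}", symmetric])
      (simp only: zero, simp only: cls_add_right)
  finally show ?thesis
    by (simp only: counit_left)
qed

lemma induced_counit: "induced (\<iota> \<circ> counit BG) (cls z) = cls z"
proof -
  have "cls (\<Sum>(b, h)\<in>#z. spread b (\<iota> \<circ> counit BG) h 1) = cls (\<Sum>(b, h)\<in>#z. {#(b, h)#})"
    by (rule cls.cong_sum) (auto simp: spread_counit)
  then show ?thesis
    by (simp add: induced_cls[OF Hom_counit] case_prod_unfold)
qed

text \<open>The order is reversed: \<open>x\<close> is applied to the component of \<open>h\<close>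
  that \<open>y\<close> leaves over, and its value multiplies from the right.\<close>

lemma induced_induced:
  assumes x: "x \<in> Hom" and y: "y \<in> Hom"
  shows "induced x (induced y (cls z)) = induced (y \<diamondop> x) (cls z)"
proof -
  have "induced x (induced y (cls z)) =
      cls (\<Sum>(b, h)\<in>#z. sw BG h (\<lambda>d e. spread (b * y d) x e 1))"
    by (simp add: induced_cls x y case_prod_unfold sum_mset_sum_mset spread_def[of _ y] sw_sum_mset)
  also have "\<dots> = cls (\<Sum>(b, h)\<in>#z. spread b (y \<diamondop> x) h 1)"
    by (rule cls.cong_sum) (auto simp: spread_conv[OF y x])
  finally show ?thesis
    by (simp add: induced_cls conv_in_Hom x y)
qed

lemma apply_counit_induced:
  assumes x: "x \<in> Hom"
  shows "apply_counit (induced x (cls {#(1, h)#})) = x h"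
proof -
  have "apply_counit (induced x (cls {#(1, h)#})) = (x \<diamondop> (\<iota> \<circ> counit BG)) h"
    by (simp add: induced_cls[OF x] apply_counit_cls spread_def sw_sum_mset conv_def)
  then show ?thesis
    by (simp only: conv_unit_right[OF x])
qed

text \<open>A formal sum for \<open>X \<otimes> k\<close>, matching the inner sum in
  \<open>tensor_map_H\<close>. Its class depends only on \<open>X\<close> and
  \<open>k\<close>.\<close>

definition append_tensor :: "'h \<Rightarrow> ('b \<times> 'h) multiset set \<Rightarrow> ('b \<times> 'h \<times> 'h) multiset" where
  "append_tensor k X = tsum (\<lambda>b h. {#(b, h, k)#}) X"

lemma append_tensor_cls:
  "cls3 (append_tensor k (cls z)) = cls3 (\<Sum>(b, h)\<in>#z. {#(b, h, k)#})"
  unfolding append_tensor_def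
  by (rule tsum_cls[OF additive_quotient_cls3], rule balancedI)
    (simp_all only: cls3_add1 cls3_add2 cls3_move1 lactH_def)

definition linear_map :: "(('b \<times> 'h) multiset set \<Rightarrow> ('b \<times> 'h) multiset set) \<Rightarrow> bool" where
  "linear_map F \<longleftrightarrow>
     (\<forall>X\<in>cp_carrier BG \<iota>. F X \<in> cp_carrier BG \<iota>) \<and>
     (\<forall>X\<in>cp_carrier BG \<iota>. \<forall>Y\<in>cp_carrier BG \<iota>. F (cp_add BG \<iota> X Y) = cp_add BG \<iota> (F X) (F Y)) \<and>
     (\<forall>b. \<forall>X\<in>cp_carrier BG \<iota>. F (cp_lact BG \<iota> b X) = cp_lact BG \<iota> b (F X)) \<and>
     (\<forall>l. \<forall>X\<in>cp_carrier BG \<iota>. F (cp_ract BG \<iota> X l) = cp_ract BG \<iota> (F X) l)"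

definition colinear_map :: "(('b \<times> 'h) multiset set \<Rightarrow> ('b \<times> 'h) multiset set) \<Rightarrow> bool" where
  "colinear_map F \<longleftrightarrow>
     (\<forall>X\<in>cp_carrier BG \<iota>. cp_coact BG \<iota> (F X) = tensor_map_H BG \<iota> F (cp_coact BG \<iota> X))"

section \<open>Linear maps on the carrier and their extension to
  \<open>B \<otimes> H \<otimes> H\<close>\<close>

context
  fixes F :: "('b \<times> 'h) multiset set \<Rightarrow> ('b \<times> 'h) multiset set"
  assumes F: "linear_map F"
begin

lemma linear_map_rep: "cls (rep (F (cls z))) = F (cls z)"
proof -
  have "F (cls z) \<in> cp_carrier BG \<iota>"
    using F cls_in_carrier unfolding linear_map_def by blast
  then obtain w where "F (cls z) = cls w"
    unfolding cp_carrier_iff by blast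
  then show ?thesis
    by (simp only: cls_rep)
qed

lemma linear_map_add: "F (cls (z + w)) = cls (rep (F (cls z)) + rep (F (cls w)))"
proof -
  have "F (cp_add BG \<iota> (cls z) (cls w)) = cp_add BG \<iota> (F (cls z)) (F (cls w))"
    using F cls_in_carrier unfolding linear_map_def by blast
  then show ?thesis
    by (simp only: cp_add_cls cp_add_def[of _ _ "F (cls z)"])
qed

lemma linear_map_zero: "F (cls {#}) = cls {#}"
proof -
  let ?Z = "rep (F (cls {#}))"
  have "cls ?Z = F (cls ({#} + {#}))"
    by (simp add: linear_map_rep)
  also have "\<dots> = cls (?Z + ?Z)"
    by (rule linear_map_add)
  finally have "cls ?Z = cls {#}"
    by (rule cls.zero_if_double)
  then show ?thesis
    by (simp only: linear_map_rep)
qed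

lemma linear_map_lact: "F (cp_lact BG \<iota> b (cls z)) = cp_lact BG \<iota> b (F (cls z))"
  using F by (simp add: linear_map_def cls_in_carrier)

lemma linear_map_ract: "F (cp_ract BG \<iota> (cls z) l) = cp_ract BG \<iota> (F (cls z)) l"
  using F by (simp add: linear_map_def cls_in_carrier)

lemma linear_map_tgt:
  "F (cls {#(b, tgt BG l * h)#}) = cls (\<Sum>(b', h')\<in>#rep (F (cls {#(b, h)#})). {#(b', tgt BG l * h')#})"
proof -
  have "F (cls {#(b, tgt BG l * h)#}) = cp_ract BG \<iota> (cls (rep (F (cls {#(b, h)#})))) l"
    by (simp only: cp_ract_pure[symmetric] linear_map_ract linear_map_rep)
  then show ?thesis
    by (simp only: cp_ract_cls)
qed

lemma append_tensor_add:
  "cls3 (append_tensor k (F (cls (z + w)))) =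
   cls3 (append_tensor k (F (cls z)) + append_tensor k (F (cls w)))"
  unfolding linear_map_add append_tensor_cls by (simp add: append_tensor_def tsum_def)

lemma append_tensor_sum:
  "cls3 (append_tensor k (F (cls z))) = cls3 (\<Sum>g\<in>#z. append_tensor k (F (cls {#g#})))"
proof (induction z)
  case empty
  then show ?case
    by (simp add: linear_map_zero append_tensor_cls)
next
  case (add g z)
  have "cls3 (append_tensor k (F (cls ({#g#} + z)))) =
      cls3 (append_tensor k (F (cls {#g#})) + append_tensor k (F (cls z)))"
    by (rule append_tensor_add)
  also have "\<dots> = cls3 (append_tensor k (F (cls {#g#})) + (\<Sum>g\<in>#z. append_tensor k (F (cls {#g#}))))"
    by (rule cls3.cong_add[OF HOL.refl add])
  finally show ?case
    by simp
qed

text \<open>Well-definedness of \<open>F \<otimes> H\<close>. Right \<open>L\<close>-linearity of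
  \<open>F\<close> gives balancedness between the two copies of \<open>H\<close>.\<close>

lemma tensor_map_H_cls3:
  "tensor_map_H BG \<iota> F (cls3 z) = cls3 (\<Sum>(b, h, k)\<in>#z. append_tensor k (F (cls {#(b, h)#})))"
proof -
  let ?f = "\<lambda>b h k. append_tensor k (F (cls {#(b, h)#}))"
  have "balanced3 cls3 (\<lambda>b l. b * \<iota> l) (lactH BG) (ractH BG) (lactH BG) ?f"
  proof (rule balanced3I)
    fix b b' h h' k k' l
    show "cls3 (?f (b + b') h k) = cls3 (?f b h k + ?f b' h k)"
      unfolding cls_add_left by (rule append_tensor_add)
    show "cls3 (?f b (h + h') k) = cls3 (?f b h k + ?f b h' k)"
      unfolding cls_add_right by (rule append_tensor_add)
    show "cls3 (?f b h (k + k')) = cls3 (?f b h k + ?f b h k')"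
      unfolding append_tensor_def tsum_def case_prod_unfold sum_mset.distrib[symmetric]
      by (rule cls3.cong_sum) (rule cls3_add3)
    show "cls3 (?f (b * \<iota> l) h k) = cls3 (?f b (lactH BG l h) k)"
      by (simp only: cls_move lactH_def)
    have "cls3 (?f b (tgt BG l * h) k) =
        cls3 (\<Sum>(b', h')\<in>#rep (F (cls {#(b, h)#})). {#(b', tgt BG l * h', k)#})"
      unfolding linear_map_tgt append_tensor_cls
      by (simp add: case_prod_unfold sum_mset_sum_mset del: sum_mset_singleton_mset)
    also have "\<dots> = cls3 (\<Sum>(b', h')\<in>#rep (F (cls {#(b, h)#})). {#(b', h', src BG l * k)#})"
      by (rule cls3.cong_sum) (auto simp: cls3_move2)
    also have "(\<Sum>(b', h')\<in>#rep (F (cls {#(b, h)#})). {#(b', h', src BG l * k)#}) =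
        ?f b h (src BG l * k)"
      by (simp only: append_tensor_def tsum_def)
    finally show "cls3 (?f b (ractH BG h l) k) = cls3 (?f b h (lactH BG l k))"
      by (simp only: ractH_def lactH_def)
  qed
  then have "cls3 (\<Sum>(b, h, k)\<in>#rep (cls3 z). ?f b h k) = cls3 (\<Sum>(b, h, k)\<in>#z. ?f b h k)"
    by (rule cls3.sum_tensor3) (simp add: clsBHH_def)
  then show ?thesis
    by (simp only: tensor_map_H_def tsum3_def append_tensor_def)
qed

end

lemma component_Hom:
  assumes F: "linear_map F"
  shows "(\<lambda>h. apply_counit (F (cls {#(1, h)#}))) \<in> Hom"
proof (rule HomI)
  fix h h' l
  let ?Z = "rep (F (cls {#(1, h)#}))"
  note rep = linear_map_rep[OF F]
  show "apply_counit (F (cls {#(1, h + h')#})) =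
      apply_counit (F (cls {#(1, h)#})) + apply_counit (F (cls {#(1, h')#}))"
    using apply_counit_add[of ?Z "rep (F (cls {#(1, h')#}))", unfolded cp_add_cls]
    by (simp only: cls_add_right linear_map_add[OF F] rep)
  \<comment> \<open>Since \<open>1 \<otimes> s(l) h\<close> equals
    \<open>\<iota>(l) \<otimes> h\<close>, left \<open>L\<close>-linearity in \<open>h\<close>
    follows from left \<open>B\<close>-linearity of \<open>F\<close>.\<close>
  have "cls {#(1, src BG l * h)#} = cp_lact BG \<iota> (\<iota> l) (cls {#(1, h)#})"
    using cls_move[of 1 l h] by (simp add: cp_lact_pure)
  then show "apply_counit (F (cls {#(1, src BG l * h)#})) = \<iota> l * apply_counit (F (cls {#(1, h)#}))"
    using apply_counit_lact[of "\<iota> l" ?Z] by (simp only: linear_map_lact[OF F] rep)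
  show "apply_counit (F (cls {#(1, tgt BG l * h)#})) = apply_counit (F (cls {#(1, h)#})) * \<iota> l"
    using apply_counit_ract[of ?Z l]
    by (simp only: cp_ract_pure[symmetric] linear_map_ract[OF F] rep)
qed

text \<open>Applying \<open>B \<otimes> \<pi> \<otimes> H\<close> to both sides of the colinearity equation at \<open>1 \<otimes> h\<close> recovers \<open>F (1 \<otimes> h)\<close>
  on the left, whereas the right-hand side becomes \<open>x(h\<^sub>1) \<otimes> h\<^sub>2\<close>.\<close>

lemma comodule_map_eq_induced:
  assumes F: "linear_map F" and co: "colinear_map F"
    and x: "x = (\<lambda>h. apply_counit (F (cls {#(1, h)#})))"
  shows "F (cls z) = induced x (cls z)"
proof -
  have Hom: "x \<in> Hom"
    unfolding x by (rule component_Hom[OF F])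
  note rep = linear_map_rep[OF F]
  have one: "F (cls {#(1, h)#}) = cls (spread 1 x h 1)" for h
  proof -
    let ?Z = "rep (F (cls {#(1, h)#}))"
    \<comment> \<open>\<open>?f\<close> realizes \<open>B \<otimes> \<pi> \<otimes> H\<close>;
      \<open>?y\<close> and \<open>?y'\<close> represent the two sides of the colinearity equation
      at \<open>1 \<otimes> h\<close>.\<close>
    let ?f = "\<lambda>b h k. {#(b * \<iota> (counit BG h), k)#}"
    let ?y = "\<Sum>(b, h)\<in>#?Z. sw BG h (\<lambda>h1 h2. {#(b, h1, h2)#})"
    let ?y' = "sw BG h (\<lambda>h1 h2. append_tensor h2 (F (cls {#(1, h1)#})))"
    have "balanced3 cls (\<lambda>b l. b * \<iota> l) (lactH BG) (ractH BG) (lactH BG) ?f"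
      by (rule balanced3I) (simp_all only: distrib_left distrib_right cls_add_left cls_add_right
          counit_add iota_add lactH_def ractH_def counit_src counit_tgt iota_mult
          mult.assoc[symmetric] cls_move)
    moreover have "cls3 ?y = cls3 ?y'"
    proof -
      have "cp_coact BG \<iota> (F (cls {#(1, h)#})) =
          tensor_map_H BG \<iota> F (cp_coact BG \<iota> (cls {#(1, h)#}))"
        using co by (simp add: colinear_map_def cls_in_carrier)
      then show ?thesis
        using cp_coact_cls[of ?Z]
        by (simp add: rep cp_coact_cls tensor_map_H_cls3[OF F] sw_sum_mset)
    qed
    ultimately have "cls (\<Sum>(b, h, k)\<in>#?y. ?f b h k) = cls (\<Sum>(b, h, k)\<in>#?y'. ?f b h k)"
      unfolding clsBHH_def by (rule cls.sum_tensor3)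
    moreover have "cls (\<Sum>(b, h, k)\<in>#?y. ?f b h k) = F (cls {#(1, h)#})"
    proof -
      have "cls (\<Sum>(b, h, k)\<in>#?y. ?f b h k) = cls (\<Sum>(b, h)\<in>#?Z. spread b (\<iota> \<circ> counit BG) h 1)"
        by (simp add: case_prod_unfold sum_mset_sum_mset sw_sum_mset spread_def
            del: sum_mset_singleton_mset)
      also have "\<dots> = induced (\<iota> \<circ> counit BG) (cls ?Z)"
        by (rule induced_cls[OF Hom_counit, symmetric])
      also have "\<dots> = cls ?Z"
        by (rule induced_counit)
      finally show ?thesis
        by (simp only: rep)
    qed
    moreover have "cls (\<Sum>(b, h, k)\<in>#?y'. ?f b h k) = cls (spread 1 x h 1)"
    proof -
      have "cls (\<Sum>(b, h, k)\<in>#append_tensor h2 (F (cls {#(1, h1)#})). ?f b h k) = cls {#(x h1, h2)#}" for h1 h2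
      proof -
        have "cls (\<Sum>(b, h)\<in>#w. {#(b * \<iota> (counit BG h), k)#}) =
            cls {#(\<Sum>(b, h)\<in>#w. b * \<iota> (counit BG h), k)#}" for w k
        proof (induction w)
          case empty
          then show ?case
            by (simp add: cls_zero_left)
        next
          case (add g w)
          show ?case
            using cls.cong_add[OF HOL.refl add, of "{#(fst g * \<iota> (counit BG (snd g)), k)#}"]
            by (simp add: case_prod_unfold cls_add_left)
        qed
        then show ?thesis
          by (simp add: x apply_counit_def append_tensor_def tsum_def case_prod_unfold
              sum_mset_sum_mset del: sum_mset_singleton_mset)
      qed
      then show ?thesis
        unfolding sw_sum_mset spread_def by (intro cls.sw_cong) simp
    qed
    ultimately show ?thesis
      by simp
  qed
  have pure: "F (cls {#(b, h)#}) = cls (spread b x h 1)" for b h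
  proof -
    have "F (cls {#(b, h)#}) = cp_lact BG \<iota> b (cls (spread 1 x h 1))"
      using linear_map_lact[OF F, of b "{#(1, h)#}"] by (simp add: cp_lact_pure one)
    then show ?thesis
      by (simp add: cp_lact_cls spread_def sw_sum_mset)
  qed
  show ?thesis
  proof (induction z)
    case empty
    then show ?case
      by (simp add: linear_map_zero[OF F] induced_cls[OF Hom])
  next
    case (add g z)
    have "F (cls ({#g#} + z)) = cls (rep (F (cls {#g#})) + rep (F (cls z)))"
      by (rule linear_map_add[OF F])
    also have "\<dots> = cls (spread (fst g) x (snd g) 1 + (\<Sum>(b, h)\<in>#z. spread b x h 1))"
      by (rule cls.cong_add)
        (use add pure[of "fst g" "snd g"] in \<open>simp_all add: rep induced_cls[OF Hom]\<close>)
    finally show ?case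
      by (simp add: induced_cls[OF Hom] case_prod_unfold)
  qed
qed

lemma linear_map_induced:
  assumes x: "x \<in> Hom"
  shows "linear_map (induced x)"
  unfolding linear_map_def
proof (intro conjI ballI allI)
  fix X Y b l assume "X \<in> cp_carrier BG \<iota>" "Y \<in> cp_carrier BG \<iota>"
  then obtain z w where [simp]: "X = cls z" "Y = cls w"
    by (auto simp: cp_carrier_def)
  show "induced x X \<in> cp_carrier BG \<iota>"
    by (simp add: induced_def cls_in_carrier)
  show "induced x (cp_add BG \<iota> X Y) = cp_add BG \<iota> (induced x X) (induced x Y)"
    by (simp add: induced_cls[OF x] cp_add_cls)
  show "induced x (cp_lact BG \<iota> b X) = cp_lact BG \<iota> b (induced x X)"
    by (simp add: induced_cls[OF x] cp_lact_cls case_prod_unfold sum_mset_sum_mset spread_def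
        sw_sum_mset mult.assoc del: sum_mset_singleton_mset)
  have "cls (spread b x (tgt BG l * h) 1) = cls (sw BG h (\<lambda>d e. {#(b * x d, tgt BG l * e)#}))" for b h
    using sw_tgt[OF additive_quotient_cls balanced_spread[OF x, of b 1], of l h] by (simp add: spread_def)
  then have "cls (\<Sum>g\<in>#z. spread (fst g) x (tgt BG l * snd g) 1) =
      cls (\<Sum>g\<in>#z. sw BG (snd g) (\<lambda>d e. {#(fst g * x d, tgt BG l * e)#}))"
    by (intro cls.cong_sum)
  then show "induced x (cp_ract BG \<iota> X l) = cp_ract BG \<iota> (induced x X) l"
    by (simp add: induced_cls[OF x] cp_ract_cls case_prod_unfold sum_mset_sum_mset
        spread_def[of _ _ _ 1] sw_sum_mset del: sum_mset_singleton_mset)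
qed

text \<open>By coassociativity both sides come to
  \<open>b x(h1) \<otimes> h2 \<otimes> h3\<close>.\<close>

lemma colinear_map_induced:
  assumes x: "x \<in> Hom"
  shows "colinear_map (induced x)"
  unfolding colinear_map_def
proof
  fix X assume "X \<in> cp_carrier BG \<iota>"
  then obtain z where z: "X = cls z"
    by (auto simp: cp_carrier_def)
  have "balanced3H BG cls3 (\<lambda>d p r. {#(b * x d, p, r)#})" for b
    by (rule balanced3I) (simp_all only: Hom_add[OF x] Hom_tgt[OF x] distrib_left cls3_add1 cls3_add2
        cls3_add3 cls3_move1 cls3_move2 ractH_def lactH_def mult.assoc[symmetric])
  note coassoc = sw_coassoc[OF additive_quotient_cls3 this]
  have append: "cls3 (append_tensor k (induced x (cls {#(b, h)#}))) =
      cls3 (sw BG h (\<lambda>d p. {#(b * x d, p, k)#}))" for b h k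
    by (simp add: induced_cls[OF x] append_tensor_cls spread_def sw_sum_mset)
  have "cp_coact BG \<iota> (induced x X) =
      cls3 (\<Sum>(b, h)\<in>#z. sw BG h (\<lambda>d e. sw BG e (\<lambda>p r. {#(b * x d, p, r)#})))"
    by (simp add: z induced_cls[OF x] cp_coact_cls case_prod_unfold sum_mset_sum_mset spread_def
        sw_sum_mset)
  also have "\<dots> = cls3 (\<Sum>(b, h)\<in>#z. sw BG h (\<lambda>d' r. sw BG d' (\<lambda>d p. {#(b * x d, p, r)#})))"
    by (intro cls3.cong_sum) (simp add: case_prod_unfold coassoc)
  also have "\<dots> = cls3 (\<Sum>(b, h)\<in>#z. sw BG h (\<lambda>d r. append_tensor r (induced x (cls {#(b, d)#}))))"
    by (intro cls3.cong_sum, unfold case_prod_unfold, intro cls3.sw_cong) (simp add: append)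
  also have "\<dots> = tensor_map_H BG \<iota> (induced x) (cp_coact BG \<iota> X)"
    by (simp add: z cp_coact_cls tensor_map_H_cls3[OF linear_map_induced[OF x]] case_prod_unfold
        sum_mset_sum_mset sw_sum_mset)
  finally show "cp_coact BG \<iota> (induced x X) = tensor_map_H BG \<iota> (induced x) (cp_coact BG \<iota> X)" .
qed

text \<open>Linearity is transported by applying \<open>G\<close> to the identities for
  \<open>F\<close>. Colinearity follows in the same way once \<open>G \<otimes> H\<close> is known
  to undo \<open>F \<otimes> H\<close>.\<close>

lemma comodule_map_inverse:
  assumes F: "linear_map F" "colinear_map F" and G: "\<And>X. X \<in> cp_carrier BG \<iota> \<Longrightarrow> G X \<in> cp_carrier BG \<iota>"
    and GF: "\<And>X. X \<in> cp_carrier BG \<iota> \<Longrightarrow> G (F X) = X"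
    and FG: "\<And>X. X \<in> cp_carrier BG \<iota> \<Longrightarrow> F (G X) = X"
  shows "linear_map G" "colinear_map G"
proof -
  have closed: "cp_add BG \<iota> X Y \<in> cp_carrier BG \<iota>" "cp_lact BG \<iota> b X \<in> cp_carrier BG \<iota>"
    "cp_ract BG \<iota> X l \<in> cp_carrier BG \<iota>" for X Y b l
    by (simp_all add: cp_add_def cp_lact_def cp_ract_def cls_in_carrier)
  show lin: "linear_map G"
    unfolding linear_map_def
  proof (intro conjI ballI allI)
    fix X Y b l assume XY: "X \<in> cp_carrier BG \<iota>" "Y \<in> cp_carrier BG \<iota>"
    show "G X \<in> cp_carrier BG \<iota>"
      by (rule G[OF XY(1)])
    have "F (cp_add BG \<iota> (G X) (G Y)) = cp_add BG \<iota> X Y"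
      using F(1) XY by (simp add: linear_map_def G FG)
    then show "G (cp_add BG \<iota> X Y) = cp_add BG \<iota> (G X) (G Y)"
      using GF[OF closed(1), of "G X" "G Y"] by simp
    have "F (cp_lact BG \<iota> b (G X)) = cp_lact BG \<iota> b X"
      using F(1) XY by (simp add: linear_map_def G FG)
    then show "G (cp_lact BG \<iota> b X) = cp_lact BG \<iota> b (G X)"
      using GF[OF closed(2), of b "G X"] by simp
    have "F (cp_ract BG \<iota> (G X) l) = cp_ract BG \<iota> X l"
      using F(1) XY by (simp add: linear_map_def G FG)
    then show "G (cp_ract BG \<iota> X l) = cp_ract BG \<iota> (G X) l"
      using GF[OF closed(3), of "G X" l] by simp
  qed
  have inverse: "tensor_map_H BG \<iota> G (tensor_map_H BG \<iota> F (cls3 z)) = cls3 z" for z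
  proof -
    have "cls3 (\<Sum>(b', h', k')\<in>#append_tensor k (F (cls {#(b, h)#})).
        append_tensor k' (G (cls {#(b', h')#}))) = cls3 {#(b, h, k)#}" for b h k
    proof -
      \<comment> \<open>The inner sum runs over a representative of \<open>F(b \<otimes> h)\<close>;
        additivity of \<open>G\<close> reassembles it, so that \<open>G\<close> cancels
        \<open>F\<close>.\<close>
      have "cls3 (\<Sum>(b', h', k')\<in>#append_tensor k (F (cls {#(b, h)#})).
          append_tensor k' (G (cls {#(b', h')#}))) =
          cls3 (\<Sum>g\<in>#rep (F (cls {#(b, h)#})). append_tensor k (G (cls {#g#})))"
        unfolding append_tensor_def[of k "F (cls {#(b, h)#})"] tsum_def
        by (simp add: case_prod_unfold sum_mset_sum_mset del: sum_mset_singleton_mset)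
      also have "\<dots> = cls3 (append_tensor k (G (cls (rep (F (cls {#(b, h)#}))))))"
        by (rule append_tensor_sum[OF lin, symmetric])
      finally show ?thesis
        by (simp add: linear_map_rep[OF F(1)] GF cls_in_carrier append_tensor_cls)
    qed
    then have "cls3 (\<Sum>g\<in>#z. \<Sum>(b', h', k')\<in>#append_tensor (snd (snd g)) (F (cls {#(fst g, fst (snd g))#})).
        append_tensor k' (G (cls {#(b', h')#}))) = cls3 (\<Sum>g\<in>#z. {#g#})"
      by (intro cls3.cong_sum) simp
    then show ?thesis
      by (simp add: tensor_map_H_cls3[OF F(1)] tensor_map_H_cls3[OF lin] case_prod_unfold
          sum_mset_sum_mset)
  qed
  show "colinear_map G"
    unfolding colinear_map_def
  proof
    fix X assume X: "X \<in> cp_carrier BG \<iota>"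
    have "cp_coact BG \<iota> (G X) = tensor_map_H BG \<iota> G (tensor_map_H BG \<iota> F (cp_coact BG \<iota> (G X)))"
      by (simp only: cp_coact_def inverse)
    also have "tensor_map_H BG \<iota> F (cp_coact BG \<iota> (G X)) = cp_coact BG \<iota> (F (G X))"
      using F(2) G[OF X] by (simp add: colinear_map_def)
    finally show "cp_coact BG \<iota> (G X) = tensor_map_H BG \<iota> G (cp_coact BG \<iota> X)"
      by (simp only: FG[OF X])
  qed
qed

section \<open>Equivalence of crossed products and gauge transforms\<close>

lemma equivalent_iff_gauge_transform:
  assumes C: "crossed_product scH scB BG \<iota> C" and D: "crossed_product scH scB BG \<iota> D"
  shows "equivalent_crossed_products BG \<iota> D C \<longleftrightarrow> is_gauge_transform_of scH scB BG \<iota> D C"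
proof
  let ?B = "cp_carrier BG \<iota>"
  assume "equivalent_crossed_products BG \<iota> D C"
  then obtain F where F: "cp_isomorphism BG \<iota> D C F"
    by (auto simp: equivalent_crossed_products_def)
  then have bij: "bij_betw F ?B ?B" and lin: "linear_map F" and co: "colinear_map F"
    by (auto simp: cp_isomorphism_def linear_map_def colinear_map_def bij_betw_def)
  define G where "G = inv_into ?B F"
  have G: "G X \<in> ?B" "F (G X) = X" "G (F X) = X" if "X \<in> ?B" for X
    using that bij unfolding G_def
    by (auto simp: bij_betw_def inv_into_into f_inv_into_f inv_into_f_f)
  note G_map = comodule_map_inverse[OF lin co G(1) G(3) G(2)]
  define x where "x = (\<lambda>h. apply_counit (F (cls {#(1, h)#})))"
  define y where "y = (\<lambda>h. apply_counit (G (cls {#(1, h)#})))"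
  have x: "x \<in> Hom" and y: "y \<in> Hom"
    unfolding x_def y_def by (rule component_Hom[OF lin] component_Hom[OF G_map(1)])+
  have Fx: "F X = induced x X" and Gy: "G X = induced y X" if "X \<in> ?B" for X
    using that comodule_map_eq_induced[OF lin co x_def] comodule_map_eq_induced[OF G_map y_def]
    by (auto simp: cp_carrier_def)
  have F_in: "F X \<in> ?B" if "X \<in> ?B" for X
    using bij that by (auto simp: bij_betw_def)
  \<comment> \<open>The composite is induced by \<open>v \<diamondop> w\<close> and is the identity,
    so applying \<open>B \<otimes> \<pi>\<close> at \<open>1 \<otimes> h\<close> leaves
    \<open>\<iota>(\<pi>(h))\<close>.\<close>
  have unit: "v \<diamondop> w = \<iota> \<circ> counit BG"
    if v: "v \<in> Hom" and w: "w \<in> Hom" and wv: "\<And>X. X \<in> ?B \<Longrightarrow> induced w (induced v X) = X" for v w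
  proof
    fix h
    have "(v \<diamondop> w) h = apply_counit (induced (v \<diamondop> w) (cls {#(1, h)#}))"
      by (simp only: apply_counit_induced[OF conv_in_Hom[OF v w]])
    also have "induced (v \<diamondop> w) (cls {#(1, h)#}) = cls {#(1, h)#}"
      by (simp only: induced_induced[OF w v, symmetric] wv[OF cls_in_carrier])
    finally show "(v \<diamondop> w) h = (\<iota> \<circ> counit BG) h"
      by (simp add: apply_counit_cls)
  qed
  have "conv_inverse scH scB BG \<iota> x y"
    unfolding conv_inverse_def
  proof (intro conjI x y)
    show "x \<diamondop> y = \<iota> \<circ> counit BG"
      by (rule unit[OF x y]) (simp only: Fx[symmetric] Gy[symmetric] F_in G)
    show "y \<diamondop> x = \<iota> \<circ> counit BG"
      by (rule unit[OF y x]) (simp only: Fx[symmetric] Gy[symmetric] G)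
  qed
  moreover have x1: "x 1 = 1"
  proof -
    have "F (cls {#(1, 1)#}) = cls {#(1, 1)#}"
      using F by (simp add: cp_isomorphism_def cp_one_def)
    then show ?thesis
      by (simp add: x_def apply_counit_cls counit_one)
  qed
  moreover have "intertwiner D C x"
  proof -
    have "cp_mult BG \<iota> D X Y \<in> ?B" for X Y
      by (simp add: cp_mult_def cls_in_carrier)
    then show ?thesis
      using F by (simp add: induced_mult_iff[OF C D x, symmetric] Fx[symmetric] cp_isomorphism_def)
  qed
  ultimately show "is_gauge_transform_of scH scB BG \<iota> D C"
    unfolding is_gauge_transform_of_def
    using intertwiner_iff_gauge_transform[OF C D] by blast
next
  let ?B = "cp_carrier BG \<iota>"
  assume "is_gauge_transform_of scH scB BG \<iota> D C"
  then obtain x y where inv: "conv_inverse scH scB BG \<iota> x y" and x1: "x 1 = 1"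
    and D_eq: "D = gauge_transform BG x y C"
    by (auto simp: is_gauge_transform_of_def)
  then have x: "x \<in> Hom" and y: "y \<in> Hom"
    and xy: "x \<diamondop> y = \<iota> \<circ> counit BG" and yx: "y \<diamondop> x = \<iota> \<circ> counit BG"
    by (auto simp: conv_inverse_def)
  note lin = linear_map_induced[OF x] and co = colinear_map_induced[OF x]
  \<comment> \<open>The convolution inverse \<open>y\<close> of \<open>x\<close> induces the inverse
    map.\<close>
  have "bij_betw (induced x) ?B ?B"
  proof (rule bij_betw_byWitness[where f' = "induced y"])
    show "\<forall>X\<in>?B. induced y (induced x X) = X"
      by (auto simp: cp_carrier_def induced_induced[OF y x] xy induced_counit)
    show "\<forall>X\<in>?B. induced x (induced y X) = X"
      by (auto simp: cp_carrier_def induced_induced[OF x y] yx induced_counit)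
  qed (auto simp: induced_def cls_in_carrier)
  moreover have "induced x (cp_one BG \<iota>) = cp_one BG \<iota>"
    using sw_one[OF additive_quotient_cls balanced_spread[OF x], of 1 1]
    by (simp add: cp_one_def induced_cls[OF x] spread_def x1)
  moreover have "intertwiner D C x"
    using intertwiner_iff_gauge_transform[OF C D inv x1] D_eq by blast
  ultimately have "cp_isomorphism BG \<iota> D C (induced x)"
    using lin co induced_mult_iff[OF C D x]
    by (auto simp: cp_isomorphism_def linear_map_def colinear_map_def)
  then show "equivalent_crossed_products BG \<iota> D C"
    by (auto simp: equivalent_crossed_products_def)
qed

end

theorem theorem4p7:
  fixes scH :: "'k::{comm_ring,comm_monoid_mult} \<Rightarrow> 'h::{ring,monoid_mult} \<Rightarrow> 'h"
    and scL :: "'k \<Rightarrow> 'l::{ring,monoid_mult} \<Rightarrow> 'l"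
    and scB :: "'k \<Rightarrow> 'b::{ring,monoid_mult} \<Rightarrow> 'b"
    and BG :: "('h, 'l) bialgebroid_data"
    and \<iota> :: "'l \<Rightarrow> 'b"
    and C Cbar :: "('h, 'b) crossed_product_data"
  assumes "left_bialgebroid scH scL BG"
    and "L_ring scL scB \<iota>"
    and "crossed_product scH scB BG \<iota> C"
    and "crossed_product scH scB BG \<iota> Cbar"
  shows "equivalent_crossed_products BG \<iota> Cbar C \<longleftrightarrow> is_gauge_transform_of scH scB BG \<iota> Cbar C"
proof -
  interpret bialgebroid_with_ring scH scL scB BG \<iota>
    using assms by (simp add: bialgebroid_with_ring_def)
  show ?thesis
    using assms by (intro equivalent_iff_gauge_transform)
qed

end
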